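(* Let $p\ge1$ be an integer, $j\in\{1,2,3\}$, and let $n\in\mathbf N_0$ have property $(j_p)$ with $D_p=\det(s_{i+l})_{i,l=0}^{p}\ne0$. Let $\sigma$ be the finite positive measure on $\mathbb R$ with $n(z)=\int_{\mathbb R}\frac{d\sigma(t)}{t-z}$, let $A$ be the operator of multiplication by the independent variable in $\mathcal H=L^2(\sigma)$, and $u(t)\equiv1$, so that $n(z)=((A-z)^{-1}u,u)$. Let $\mathcal H_p=\operatorname{span}\{1,t,\dots,t^{p-1}\}$, $\mathcal H_p'=\mathcal H\ominus\mathcal H_p$, let $A_0$ be the compression of $A$ to $\mathcal H_p$ and $D$ the compression of $A$ to $\mathcal H_p'$ (a self-adjoint, possibly unbounded operator in $\mathcal H_p'$). Let $e_0,\dots,e_p$ be the polynomials of the first kind associated with $n$, let $b_{p-1}=(Ae_{p-1},e_p)>0$ and $u_p:=b_{p-1}e_p\in\mathcal H_p'$. For $z\in\mathbb C\setminus\mathbb R$ set $$a_{00}(z)=((A_0-z)^{-1}u,u),\quad a_{11}(z)=((A_0-z)^{-1}e_{p-1},e_{p-1}),\quad a(z)=((A_0-z)^{-1}u,e_{p-1}),$$ $$\check r(z)=a_{00}(z)a_{11}(z)-a(z)^2,\qquad n_p(z)=((D-z)^{-1}u_p,u_p).$$ Then $$n(z)=\frac{\check r(z)\,n_p(z)-a_{00}(z)}{a_{11}(z)\,n_p(z)-1},\qquad z\in\mathbb C\setminus\mathbb R.$$ The function $n_p$ belongs to $\mathbf N_0$ and has property $(j_0)$. Moreover, for every integer $k\ge1$,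 $$u\in\operatorname{dom}A^{p+k}\iff u_p\in\operatorname{dom}D^k,$$ and $n$ has property $(j_{p+k})$ if and only if $n_p$ has property $(j_k)$.
   Context: A Nevanlinna function is a function $n$ that is analytic in the open upper half plane $\mathbb C^+$ with $\operatorname{Im} n(z)\ge 0$ for $z\in\mathbb C^+$; it is always extended to the lower half plane by $n(z)=n(z^* )^*$, where $z^*$ denotes the complex conjugate. $\mathbf N_0$ denotes the set of all Nevanlinna functions. For $m\in\mathbf N_0$ and an integer $q\ge0$ the properties $(1_q),(2_q),(3_q)$ mean that there are real numbers $s_0,s_1,\dots$ (depending on $m$) such that, for $z=iy$, $y\to\pm\infty$: $(1_q)$: $m(z)=-\frac{s_0}{z}-\frac{s_1}{z^2}-\cdots-\frac{s_{2q}}{z^{2q+1}}+\mathrm o\!\left(\frac1{z^{2q+1}}\right)$; $(2_q)$: $m(z)=-\frac{s_0}{z}-\cdots-\frac{s_{2q}}{z^{2q+1}}+\mathrm O\!\left(\frac1{z^{2q+2}}\right)$; $(3_q)$: $m(z)=-\frac{s_0}{z}-\cdots-\frac{s_{2q+1}}{z^{2q+2}}+\mathrm o\!\left(\frac1{z^{2q+2}}\right)$. Clearly $(3_q)\Rightarrow(2_q)\Rightarrow(1_q)$. If $n$ has property $(1_p)$, then $n(z)=\int_{\mathbb R}\frac{d\sigma(t)}{t-z}$ with a unique finite positive Borel measure $\sigma$, and $s_i=\int t^i\,d\sigma(t)$ for $0\le i\le 2p$; in particular $1,t,\dots,t^p\in L^2(\sigma)$ and $1,t,\dots,t^{p-1}\in\operatorname{dom}A$.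 The polynomials of the first kind $e_0,\dots,e_p$ associated with $n$ are obtained by Gram–Schmidt orthonormalization of $1,t,\dots,t^p$ in $L^2(\sigma)$: $e_k$ is a real polynomial of degree $k$ with positive leading coefficient and $(e_i,e_k)=\delta_{ik}$. They satisfy $te_k=b_{k-1}e_{k-1}+a_ke_k+b_ke_{k+1}$, $0\le k\le p-1$, with $b_{-1}=0$, $a_k$ real, $b_k>0$. The compression of $A$ to a closed subspace $\mathcal K$ is $P_{\mathcal K}A|_{\mathcal K}$ with domain $\operatorname{dom}A\cap\mathcal K$, $P_{\mathcal K}$ being the orthogonal projection onto $\mathcal K$. *)

theory Defs
  imports
    "HOL-Analysis.Analysis"
    "HOL-Library.Landau_Symbols"
    "HOL-Computational_Algebra.Polynomial"
    "Jordan_Normal_Form.Determinant"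
begin

(* Values on the real axis are left unconstrained. *)
definition nevanlinna :: "(complex \<Rightarrow> complex) \<Rightarrow> bool" where
  "nevanlinna n \<longleftrightarrow>
     n analytic_on {z. Im z > 0} \<and>
     (\<forall>z. Im z > 0 \<longrightarrow> Im (n z) \<ge> 0) \<and>
     (\<forall>z. Im z < 0 \<longrightarrow> n z = cnj (n (cnj z)))"

definition asymptotic_sum :: "(nat \<Rightarrow> real) \<Rightarrow> nat \<Rightarrow> complex \<Rightarrow> complex" where
  "asymptotic_sum s N z = - (\<Sum>i\<le>N. complex_of_real (s i) / z ^ (i + 1))"

(* The expansions of types (1_q), (2_q), (3_q) with coefficients s along z = iy.
   On the reals, at_infinity is the supremum of at_top and at_bot. *)
definition has_expansion :: "nat \<Rightarrow> nat \<Rightarrow> (complex \<Rightarrow> complex) \<Rightarrow> (nat \<Rightarrow> real) \<Rightarrow> bool" where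
  "has_expansion j q m s \<longleftrightarrow>
     j = 1 \<and> (\<lambda>y::real. m (\<i> * of_real y) - asymptotic_sum s (2 * q) (\<i> * of_real y))
        \<in> o[at_infinity](\<lambda>y. 1 / (\<i> * of_real y) ^ (2 * q + 1)) \<or>
     j = 2 \<and> (\<lambda>y::real. m (\<i> * of_real y) - asymptotic_sum s (2 * q) (\<i> * of_real y))
        \<in> O[at_infinity](\<lambda>y. 1 / (\<i> * of_real y) ^ (2 * q + 2)) \<or>
     j = 3 \<and> (\<lambda>y::real. m (\<i> * of_real y) - asymptotic_sum s (2 * q + 1) (\<i> * of_real y))
        \<in> o[at_infinity](\<lambda>y. 1 / (\<i> * of_real y) ^ (2 * q + 2))"

definition has_property :: "nat \<Rightarrow> nat \<Rightarrow> (complex \<Rightarrow> complex) \<Rightarrow> bool" where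
  "has_property j q m \<longleftrightarrow> (\<exists>s. has_expansion j q m s)"

(* Elements of the Hilbert space L^2(\<sigma>) are handled through representatives, so equality in
   L^2(\<sigma>) is equality almost everywhere.  Subspaces are sets of representatives, and operators
   are graphs; all those built below are closed under changing representatives. *)
definition L2 :: "real measure \<Rightarrow> (real \<Rightarrow> complex) set" where
  "L2 \<sigma> = {f \<in> borel_measurable \<sigma>. integrable \<sigma> (\<lambda>t. (cmod (f t))\<^sup>2)}"

definition ip :: "real measure \<Rightarrow> (real \<Rightarrow> complex) \<Rightarrow> (real \<Rightarrow> complex) \<Rightarrow> complex" where
  "ip \<sigma> f g = (\<integral>t. f t * cnj (g t) \<partial>\<sigma>)"

definition L2_norm :: "real measure \<Rightarrow> (real \<Rightarrow> complex) \<Rightarrow> real" where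
  "L2_norm \<sigma> f = sqrt (\<integral>t. (cmod (f t))\<^sup>2 \<partial>\<sigma>)"

definition ortho :: "real measure \<Rightarrow> (real \<Rightarrow> complex) set \<Rightarrow> (real \<Rightarrow> complex) set" where
  "ortho \<sigma> K = {f \<in> L2 \<sigma>. \<forall>g\<in>K. ip \<sigma> f g = 0}"

definition proj :: "real measure \<Rightarrow> (real \<Rightarrow> complex) set \<Rightarrow> (real \<Rightarrow> complex) rel" where
  "proj \<sigma> K = {(h, g). h \<in> L2 \<sigma> \<and> g \<in> K \<and> (\<lambda>t. h t - g t) \<in> ortho \<sigma> K}"

definition mult_op :: "real measure \<Rightarrow> (real \<Rightarrow> complex) rel" where
  "mult_op \<sigma> = {(f, g). f \<in> L2 \<sigma> \<and> g \<in> L2 \<sigma> \<and> (AE t in \<sigma>. g t = of_real t * f t)}"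

definition compression ::
  "real measure \<Rightarrow> (real \<Rightarrow> complex) rel \<Rightarrow> (real \<Rightarrow> complex) set \<Rightarrow> (real \<Rightarrow> complex) rel" where
  "compression \<sigma> T K = {(f, g). f \<in> K \<and> (f, g) \<in> T O proj \<sigma> K}"

definition adjoint_in ::
  "real measure \<Rightarrow> (real \<Rightarrow> complex) set \<Rightarrow> (real \<Rightarrow> complex) rel \<Rightarrow> (real \<Rightarrow> complex) rel" where
  "adjoint_in \<sigma> K T = {(g, g'). g \<in> K \<and> g' \<in> K \<and> (\<forall>(f, f')\<in>T. ip \<sigma> f' g = ip \<sigma> f g')}"

definition self_adjoint_in ::
  "real measure \<Rightarrow> (real \<Rightarrow> complex) set \<Rightarrow> (real \<Rightarrow> complex) rel \<Rightarrow> bool" where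
  "self_adjoint_in \<sigma> K T \<longleftrightarrow>
     (\<forall>f\<in>K. \<forall>\<epsilon>>0. \<exists>g\<in>Domain T. L2_norm \<sigma> (\<lambda>t. f t - g t) < \<epsilon>) \<and>
     T = adjoint_in \<sigma> K T"

(* The graph of the operator (T - z)^{-1}. *)
definition resolvent :: "(real \<Rightarrow> complex) rel \<Rightarrow> complex \<Rightarrow> (real \<Rightarrow> complex) rel" where
  "resolvent T z = {(\<lambda>t. g t - z * f t, f) | f g. (f, g) \<in> T}"

(* A representative of T f; meaningful for f in the domain of a single-valued T. *)
definition app :: "(real \<Rightarrow> complex) rel \<Rightarrow> (real \<Rightarrow> complex) \<Rightarrow> real \<Rightarrow> complex" where
  "app T f = (SOME g. (f, g) \<in> T)"

definition poly_span :: "real measure \<Rightarrow> nat \<Rightarrow> (real \<Rightarrow> complex) set" where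
  "poly_span \<sigma> p =
     {f \<in> L2 \<sigma>. \<exists>c :: nat \<Rightarrow> complex. AE t in \<sigma>. f t = (\<Sum>i<p. c i * of_real t ^ i)}"

definition poly_fun :: "real poly \<Rightarrow> real \<Rightarrow> complex" where
  "poly_fun q t = complex_of_real (poly q t)"

(* These conditions determine e 0, ..., e p uniquely as the Gram-Schmidt orthonormalization of
   1, t, ..., t^p in L^2(\<sigma>). *)
definition first_kind_polys :: "real measure \<Rightarrow> nat \<Rightarrow> (nat \<Rightarrow> real poly) \<Rightarrow> bool" where
  "first_kind_polys \<sigma> p e \<longleftrightarrow>
     (\<forall>k\<le>p. degree (e k) = k \<and> lead_coeff (e k) > 0) \<and>
     (\<forall>i\<le>p. \<forall>k\<le>p. ip \<sigma> (poly_fun (e i)) (poly_fun (e k)) = (if i = k then 1 else 0))"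

end

theory Submission
  imports Defs
begin

text \<open>
  Write \<open>\<psi>\<^sub>k(z) = \<integral> e\<^sub>k(t) / (t - z) d\<sigma>(t)\<close>. Orthogonality gives
  \<open>\<integral> e\<^sub>k q / (t - z) d\<sigma> = q(z) \<psi>\<^sub>k(z)\<close> for polynomials \<open>q\<close> of degree at most \<open>k\<close>; hence \<open>e\<^sub>k\<close> and \<open>\<psi>\<^sub>k\<close>
  have no nonreal zeros, and all resolvents can be written down:
  \<open>a\<^sub>0\<^sub>0 = n - \<psi>\<^sub>p / e\<^sub>p\<close>, \<open>a = - 1 / (b e\<^sub>p)\<close>, \<open>a\<^sub>1\<^sub>1 = - e\<^bsub>p-1\<^esub> / (b e\<^sub>p)\<close> and \<open>n\<^sub>p = - b \<psi>\<^sub>p / \<psi>\<^bsub>p-1\<^esub>\<close>.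
  Together with \<open>e\<^bsub>p-1\<^esub> \<psi>\<^sub>p - e\<^sub>p \<psi>\<^bsub>p-1\<^esub> = 1 / b\<close> this yields the formula for \<open>n\<close>. Along the imaginary axis
  \<open>a\<^sub>0\<^sub>0\<close>, \<open>a\<close> and \<open>a\<^sub>1\<^sub>1\<close> are rational functions of \<open>1 / z\<close>, and \<open>a\<^sup>2\<close> vanishes exactly to order \<open>2 p\<close>, so the
  Moebius transformation shifts the order of an expansion by \<open>2 p\<close>. Finally \<open>D\<close> acts as
  \<open>D f = t f - (f, u\<^sub>p) e\<^bsub>p-1\<^esub>\<close>, so \<open>D\<^sup>i u\<^sub>p\<close> is a polynomial of degree \<open>p + i\<close>, which settles the domains.
\<close>

section \<open>Asymptotic expansions along the imaginary axis\<close>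

text \<open>Two obstacles shape the proof. First, vectors are functions up to null sets, operators
  are graphs, and \<open>app\<close> selects some image; so every formula for a resolvent needs an
  explicit preimage together with uniqueness almost everywhere. For all compressions at once,
  uniqueness follows from the form ((t - z) f, f), whose imaginary part is - Im z times the squared
  norm of f. Second, a Moebius transformation mixes the coefficients of an expansion. Instead of
  tracking them, the proof works with the class of functions that agree with some polynomial in 1 /
  z up to a given error. This class is a ring in which functions with nonzero limit are invertible,
  so expandability passes through rational operations; the coefficients reappear only in the
  translation to \<open>has_property\<close>. The formula n = a00 - a^2 n_p / (a11 n_p - 1) is then
  split at A_fun = n_p / (1 - a11 n_p): one step is a Moebius transformation that preserves the
  order, the other is multiplication by a^2, which changes it by 2 p. The latter is reversible
  because a polynomial in 1 / z of size O(z^(-2p)) is divisible by that power of 1 / z.\<close>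

definition rpoly :: "real poly \<Rightarrow> complex \<Rightarrow> complex" where
  "rpoly q = poly (map_poly complex_of_real q)"

lemma rpoly_0 [simp]: "rpoly 0 z = 0"
  by (simp add: rpoly_def)

lemma rpoly_pCons [simp]: "rpoly (pCons a q) z = of_real a + z * rpoly q z"
  by (simp add: rpoly_def map_poly_pCons)

lemma rpoly_1 [simp]: "rpoly 1 z = 1"
  by (simp add: one_pCons)

lemma rpoly_add [simp]: "rpoly (q + r) z = rpoly q z + rpoly r z"
proof (induction q arbitrary: r)
  case (pCons a q)
  then show ?case by (cases r) (simp add: algebra_simps)
qed simp

lemma rpoly_smult [simp]: "rpoly (Polynomial.smult c q) z = of_real c * rpoly q z"
  by (induction q) (simp_all add: algebra_simps)

lemma rpoly_uminus [simp]: "rpoly (- q) z = - rpoly q z"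
  by (induction q) simp_all

lemma rpoly_diff [simp]: "rpoly (q - r) z = rpoly q z - rpoly r z"
  using rpoly_add[of q "- r" z] by simp

lemma rpoly_mult [simp]: "rpoly (q * r) z = rpoly q z * rpoly r z"
  by (induction q) (simp_all add: algebra_simps)

lemma rpoly_power [simp]: "rpoly (q ^ k) z = rpoly q z ^ k"
  by (induction k) simp_all

lemma rpoly_sum [simp]: "rpoly (\<Sum>i\<in>I. f i) z = (\<Sum>i\<in>I. rpoly (f i) z)"
  by (induction I rule: infinite_finite_induct) simp_all

lemma rpoly_monom [simp]: "rpoly (monom c k) z = of_real c * z ^ k"
  by (simp add: rpoly_def map_poly_monom poly_monom)

lemma rpoly_of_real [simp]: "rpoly q (of_real x) = of_real (poly q x)"
  by (induction q) simp_all

lemma continuous_rpoly: "continuous_on S (rpoly q)"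
  unfolding rpoly_def by (intro continuous_intros)

lemma rpoly_altdef: "rpoly q z = (\<Sum>i\<le>degree q. of_real (coeff q i) * z ^ i)"
  by (simp add: rpoly_def poly_altdef coeff_map_poly degree_map_poly)

text \<open>Changes from z to the variable 1 / z, in which expansions at infinity are
  written.\<close>

lemma rpoly_reflect_poly:
  assumes "z \<noteq> 0"
  shows "rpoly (reflect_poly q) (1 / z) * z ^ degree q = rpoly q z"
proof -
  have "map_poly complex_of_real (reflect_poly q) = reflect_poly (map_poly of_real q)"
    by (rule poly_eqI) (simp add: coeff_map_poly coeff_reflect_poly degree_map_poly)
  moreover have "degree (map_poly complex_of_real q) = degree q"
    by (simp add: degree_map_poly)
  ultimately show ?thesis
    using assms poly_reflect_poly_nz[of "1 / z" "map_poly complex_of_real q"]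
    by (simp add: rpoly_def field_simps inverse_eq_divide)
qed

text \<open>The local variable 1 / z at infinity along z = iy: an expansion in descending powers of
  z becomes a Taylor polynomial at \<open>xi = 0\<close>. Division by zero gives
  \<open>xi 0 = 0\<close>, a point that \<open>at_infinity\<close> never sees.\<close>

definition xi :: "real \<Rightarrow> complex" where
  "xi y = 1 / (\<i> * of_real y)"

lemma xi_nonzero: "\<forall>\<^sub>F y in at_infinity. xi y \<noteq> 0"
  unfolding eventually_at_infinity xi_def by (intro exI[of _ 1]) auto

lemma tendsto_xi: "(xi \<longlongrightarrow> 0) at_infinity"
proof (rule tendsto_norm_zero_cancel)
  have "((\<lambda>y::real. norm (inverse y)) \<longlongrightarrow> 0) at_infinity"
    using tendsto_inverse_0 tendsto_norm_zero by blast
  then show "((\<lambda>y. norm (xi y)) \<longlongrightarrow> 0) at_infinity"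
    by (simp add: xi_def norm_divide norm_mult inverse_eq_divide)
qed

lemma tendsto_rpoly_xi: "((\<lambda>y. rpoly q (xi y)) \<longlongrightarrow> of_real (coeff q 0)) at_infinity"
proof -
  have "((\<lambda>y. rpoly q (xi y)) \<longlongrightarrow> rpoly q 0) at_infinity"
    using tendsto_xi continuous_rpoly[of UNIV q]
    by (metis continuous_on_tendsto_compose UNIV_I eventually_True always_eventually)
  moreover have "rpoly q 0 = of_real (coeff q 0)"
    by (cases q) simp
  ultimately show ?thesis by simp
qed

lemma tendsto_bounded: "(f \<longlongrightarrow> c) F \<Longrightarrow> f \<in> O[F](\<lambda>_. 1)"
  by (rule bigoI_tendsto[of _ _ c]) auto

lemma rpoly_xi_bounded: "(\<lambda>y. rpoly q (xi y)) \<in> O[at_infinity](\<lambda>_. 1)"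
  by (rule tendsto_bounded[OF tendsto_rpoly_xi])

text \<open>The Boolean merges o (true) and O (false), so that each closure property is proved once
  for all three types of expansion; only \<open>j = 2\<close> uses O.\<close>

definition err :: "bool \<Rightarrow> nat \<Rightarrow> (real \<Rightarrow> complex) set" where
  "err b M = (if b then o[at_infinity](\<lambda>y. xi y ^ M) else O[at_infinity](\<lambda>y. xi y ^ M))"

lemma err_add: "f \<in> err b M \<Longrightarrow> g \<in> err b M \<Longrightarrow> (\<lambda>y. f y + g y) \<in> err b M"
  by (auto simp: err_def intro: sum_in_bigo sum_in_smallo)

lemma err_uminus: "f \<in> err b M \<Longrightarrow> (\<lambda>y. - f y) \<in> err b M"
  by (auto simp: err_def)

lemma err_mult: "f \<in> O[at_infinity](\<lambda>_. 1) \<Longrightarrow> g \<in> err b M \<Longrightarrow> (\<lambda>y. f y * g y) \<in> err b M"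
  using landau_o.big_1_mult[of g at_infinity "\<lambda>y. xi y ^ M" f]
    landau_o.small_1_mult[of g at_infinity "\<lambda>y. xi y ^ M" f]
  by (auto simp: err_def mult.commute)

lemma err_cong:
  assumes "\<forall>\<^sub>F y in at_infinity. f y = g y"
  shows "f \<in> err b M \<longleftrightarrow> g \<in> err b M"
  using landau_o.big.in_cong[OF assms] landau_o.small.in_cong[OF assms] by (simp add: err_def)

text \<open>The factor cancels because \<open>xi\<close> is eventually nonzero. Having an
  equivalence here is what makes the shift of the order reversible.\<close>

lemma err_shift: "(\<lambda>y. xi y ^ k * f y) \<in> err b (k + M) \<longleftrightarrow> f \<in> err b M"
proof -
  have nz: "\<forall>\<^sub>F y in at_infinity. xi y ^ k \<noteq> 0"
    using xi_nonzero by eventually_elim simp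
  show ?thesis
    unfolding err_def power_add
    using landau_o.big.mult_cancel_left[OF bigtheta_refl nz, of f "\<lambda>y. xi y ^ M"]
      landau_o.small.mult_cancel_left[OF bigtheta_refl nz, of f "\<lambda>y. xi y ^ M"]
    by simp
qed

lemma xi_power_small:
  assumes "M < N"
  shows "(\<lambda>y. xi y ^ N) \<in> o[at_infinity](\<lambda>y. xi y ^ M)"
proof -
  obtain k where N: "N = M + Suc k"
    using assms less_iff_Suc_add by auto
  have "((\<lambda>y. xi y ^ Suc k) \<longlongrightarrow> 0 ^ Suc k) at_infinity"
    by (intro tendsto_intros tendsto_xi)
  then have "(\<lambda>y. xi y ^ Suc k) \<in> o[at_infinity](\<lambda>y. 1)"
    by (intro smalloI_tendsto) auto
  from landau_o.small.mult_left[OF this, of "\<lambda>y. xi y ^ M"] show ?thesis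
    unfolding N power_add by simp
qed

lemma xi_power_big: "M \<le> N \<Longrightarrow> (\<lambda>y. xi y ^ N) \<in> O[at_infinity](\<lambda>y. xi y ^ M)"
  using xi_power_small[of M N] by (cases "M = N") (auto intro: landau_o.small_imp_big)

lemma bigo_in_err:
  assumes "f \<in> O[at_infinity](\<lambda>y. xi y ^ N)" "M < N \<or> \<not> b \<and> M \<le> N"
  shows "f \<in> err b M"
  using assms xi_power_small[of M N] xi_power_big[of M N]
  by (auto simp: err_def intro: landau_o.big_small_trans landau_o.big_trans)

lemma err_bigo:
  assumes "f \<in> err b M" "N \<le> M"
  shows "f \<in> O[at_infinity](\<lambda>y. xi y ^ N)"
  using assms xi_power_big[OF assms(2)]
  by (auto simp: err_def split: if_splits intro: landau_o.big_trans landau_o.small_imp_big)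

lemma err_tendsto:
  assumes "f \<in> err b M" "M \<ge> 1"
  shows "(f \<longlongrightarrow> 0) at_infinity"
proof -
  have "f \<in> O[at_infinity](\<lambda>y. xi y ^ 1)"
    using assms err_bigo by blast
  also have "(\<lambda>y. xi y ^ 1) \<in> o[at_infinity](\<lambda>y. xi y ^ 0)"
    by (rule xi_power_small) simp
  finally show ?thesis
    using smalloD_tendsto by fastforce
qed

text \<open>The polynomial may have any degree: its terms beyond the order of the error are harmless.
  This is what makes the expandable functions closed under products and quotients.\<close>
definition expandable :: "bool \<Rightarrow> nat \<Rightarrow> (real \<Rightarrow> complex) \<Rightarrow> bool" where
  "expandable b M f \<longleftrightarrow> (\<exists>q. (\<lambda>y. f y - rpoly q (xi y)) \<in> err b M)"

lemma expandable_rpoly: "expandable b M (\<lambda>y. rpoly q (xi y))"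
  unfolding expandable_def by (rule exI[of _ q]) (simp add: err_def)

lemma expandable_cong:
  assumes "\<forall>\<^sub>F y in at_infinity. f y = g y"
  shows "expandable b M f \<longleftrightarrow> expandable b M g"
proof -
  have "(\<lambda>y. f y - rpoly q (xi y)) \<in> err b M \<longleftrightarrow> (\<lambda>y. g y - rpoly q (xi y)) \<in> err b M" for q
    by (rule err_cong) (use assms in eventually_elim, simp)
  then show ?thesis by (simp add: expandable_def)
qed

lemma expandable_bounded:
  assumes "expandable b M f"
  shows "f \<in> O[at_infinity](\<lambda>_. 1)"
proof -
  obtain q where "(\<lambda>y. f y - rpoly q (xi y)) \<in> err b M"
    using assms by (auto simp: expandable_def)
  then have "(\<lambda>y. f y - rpoly q (xi y)) \<in> O[at_infinity](\<lambda>_. 1)"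
    using err_bigo[of _ b M 0] by simp
  from sum_in_bigo(1)[OF this rpoly_xi_bounded[of q]] show ?thesis by simp
qed

lemma expandable_add:
  assumes "expandable b M f" "expandable b M g"
  shows "expandable b M (\<lambda>y. f y + g y)"
proof -
  obtain q r where "(\<lambda>y. f y - rpoly q (xi y)) \<in> err b M" "(\<lambda>y. g y - rpoly r (xi y)) \<in> err b M"
    using assms by (auto simp: expandable_def)
  from err_add[OF this] show ?thesis
    unfolding expandable_def by (intro exI[of _ "q + r"]) (simp add: algebra_simps)
qed

lemma expandable_mult:
  assumes "expandable b M f" "expandable b M g"
  shows "expandable b M (\<lambda>y. f y * g y)"
proof -
  obtain q r where q: "(\<lambda>y. f y - rpoly q (xi y)) \<in> err b M"
    and r: "(\<lambda>y. g y - rpoly r (xi y)) \<in> err b M"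
    using assms by (auto simp: expandable_def)
  have "(\<lambda>y. f y * (g y - rpoly r (xi y)) + rpoly r (xi y) * (f y - rpoly q (xi y))) \<in> err b M"
    by (intro err_add err_mult q r expandable_bounded[OF assms(1)] rpoly_xi_bounded)
  then show ?thesis
    unfolding expandable_def by (intro exI[of _ "q * r"]) (simp add: algebra_simps)
qed

lemma expandable_uminus:
  assumes "expandable b M f"
  shows "expandable b M (\<lambda>y. - f y)"
  using expandable_mult[OF expandable_rpoly[of b M "[:-1:]"] assms] by simp

lemma expandable_diff:
  assumes "expandable b M f" "expandable b M g"
  shows "expandable b M (\<lambda>y. f y - g y)"
  using expandable_add[OF assms(1) expandable_uminus[OF assms(2)]] by simp

text \<open>A polynomial with nonzero constant term is a unit modulo x^m. Up to scaling it is 1 - h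
  with h divisible by x, and the truncated geometric series in h inverts it; the induction adds one
  term of that series at a time.\<close>

lemma poly_inverse_modulo_power:
  fixes q :: "'a::field poly"
  assumes "coeff q 0 \<noteq> 0"
  shows "\<exists>r s. q * r = 1 - monom 1 m * s"
proof -
  define h where "h = 1 - Polynomial.smult (inverse (coeff q 0)) q"
  have "coeff h 0 = 0" using assms by (simp add: h_def)
  then have "[:0, 1:] dvd h"
    by (metis dvd_iff_poly_eq_0 minus_zero poly_0_coeff_0)
  then have "[:0, 1:] ^ m dvd h ^ m" by (rule dvd_power_same)
  then obtain s where s: "h ^ m = monom 1 m * s"
    by (auto simp: monom_altdef)
  have "\<exists>r. q * r = 1 - h ^ m"
  proof (induction m)
    case (Suc m)
    then obtain r where r: "q * r = 1 - h ^ m" by blast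
    have "q * (r + Polynomial.smult (inverse (coeff q 0)) (1 - q * r)) = q * r + (1 - h) * (1 - q * r)"
      by (simp add: h_def algebra_simps)
    also have "\<dots> = 1 - h ^ Suc m" by (simp add: r algebra_simps)
    finally show ?case by blast
  qed (auto intro: exI[of _ 0])
  then show ?thesis using s by metis
qed

text \<open>As \<open>M \<ge> 1\<close>, the error vanishes in the limit, so c is the constant term
  of the approximant q, and q has an inverse r modulo a power of x. Then 1 / f - r = ((1 - q r) - r
  (f - q)) / f, where 1 / f is bounded and both terms of the numerator are errors.\<close>

lemma expandable_inverse:
  assumes f: "expandable b M f" and lim: "(f \<longlongrightarrow> c) at_infinity" and c: "c \<noteq> 0"
    and M: "M \<ge> 1"
  shows "expandable b M (\<lambda>y. 1 / f y)"
proof -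
  obtain q where q: "(\<lambda>y. f y - rpoly q (xi y)) \<in> err b M"
    using f by (auto simp: expandable_def)
  have "((\<lambda>y. f y - (f y - rpoly q (xi y))) \<longlongrightarrow> c - 0) at_infinity"
    by (intro tendsto_diff lim err_tendsto[OF q M])
  then have "c = of_real (coeff q 0)"
    using tendsto_rpoly_xi[of q] tendsto_unique[of at_infinity]
    by (metis (no_types, lifting) LIM_cong diff_diff_eq2 diff_zero add_diff_cancel_left' ext trivial_limit_at_infinity)
  with c have "coeff q 0 \<noteq> 0" by auto
  \<comment> \<open>The exponent is \<open>Suc M\<close> because \<open>xi ^ M\<close> itself is not
    o of \<open>xi ^ M\<close>.\<close>
  from poly_inverse_modulo_power[OF this, of "Suc M"] obtain r s
    where rs: "q * r = 1 - monom 1 (Suc M) * s" by blast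
  have *: "rpoly q x * rpoly r x = 1 - x ^ Suc M * rpoly s x" for x
    using arg_cong[OF rs, of "\<lambda>q. rpoly q x"] by simp
  have bdd: "(\<lambda>y. 1 / f y) \<in> O[at_infinity](\<lambda>_. 1)"
    by (rule tendsto_bounded[of _ "1 / c"]) (intro tendsto_intros lim c)
  have "(\<lambda>y. xi y ^ Suc M) \<in> err b M"
    by (rule bigo_in_err[of _ "Suc M"]) simp_all
  then have "(\<lambda>y. rpoly s (xi y) * xi y ^ Suc M) \<in> err b M"
    by (rule err_mult[OF rpoly_xi_bounded])
  then have err: "(\<lambda>y. 1 / f y * (rpoly s (xi y) * xi y ^ Suc M
      + - (rpoly r (xi y) * (f y - rpoly q (xi y))))) \<in> err b M"
    by (rule err_mult[OF bdd err_add[OF _ err_uminus[OF err_mult[OF rpoly_xi_bounded q]]]])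
  have "\<forall>\<^sub>F y in at_infinity. f y \<noteq> 0"
    by (rule tendsto_imp_eventually_ne[OF lim c])
  then have eq: "\<forall>\<^sub>F y in at_infinity. 1 / f y * (rpoly s (xi y) * xi y ^ Suc M
      + - (rpoly r (xi y) * (f y - rpoly q (xi y)))) = 1 / f y - rpoly r (xi y)"
  proof eventually_elim
    case (elim y)
    have "rpoly s (xi y) * xi y ^ Suc M + - (rpoly r (xi y) * (f y - rpoly q (xi y)))
        = (xi y ^ Suc M * rpoly s (xi y) + rpoly q (xi y) * rpoly r (xi y)) - rpoly r (xi y) * f y"
      by (simp add: algebra_simps)
    also have "\<dots> = 1 - rpoly r (xi y) * f y"
      unfolding * by simp
    finally show ?case using elim by (simp add: field_simps)
  qed
  show ?thesis
    unfolding expandable_def using iffD1[OF err_cong[OF eq] err] by blast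
qed

lemma expandable_divide_rpoly:
  assumes "expandable b M f" "coeff q 0 \<noteq> 0" "M \<ge> 1"
  shows "expandable b M (\<lambda>y. f y / rpoly q (xi y))"
  using expandable_mult[OF assms(1) expandable_inverse[OF expandable_rpoly tendsto_rpoly_xi _ assms(3)]]
    assms(2) by simp

text \<open>Peels off one constant term at a time: it is the limit of the polynomial as
  \<open>xi\<close> tends to 0 and therefore vanishes.\<close>

lemma rpoly_xi_bigo_dvd:
  assumes "(\<lambda>y. rpoly q (xi y)) \<in> O[at_infinity](\<lambda>y. xi y ^ k)"
  shows "\<exists>r. q = monom 1 k * r"
  using assms
proof (induction k arbitrary: q)
  case (Suc k)
  obtain a r where q: "q = pCons a r" by (cases q)
  have "(\<lambda>y. rpoly q (xi y)) \<in> err False (Suc k)" using Suc.prems by (simp add: err_def)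
  then have "((\<lambda>y. rpoly q (xi y)) \<longlongrightarrow> 0) at_infinity" by (rule err_tendsto) simp
  from tendsto_unique[OF trivial_limit_at_infinity this tendsto_rpoly_xi] have "a = 0" by (simp add: q)
  then have "(\<lambda>y. xi y ^ 1 * rpoly r (xi y)) \<in> err False (1 + k)"
    using Suc.prems by (simp add: q err_def)
  then have "(\<lambda>y. rpoly r (xi y)) \<in> O[at_infinity](\<lambda>y. xi y ^ k)"
    unfolding err_shift by (simp add: err_def)
  from Suc.IH[OF this] \<open>a = 0\<close> q show ?case by (auto simp: monom_Suc)
qed (auto simp: monom_0)

text \<open>The backward shift is immediate from \<open>err_shift\<close>. For the other direction,
  boundedness of f makes the approximant of \<open>xi ^ k * f\<close> itself O of
  \<open>xi ^ k\<close>; hence it is divisible by x^k, and the quotient approximates f.\<close>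

lemma expandable_shift:
  assumes bdd: "f \<in> O[at_infinity](\<lambda>_. 1)"
  shows "expandable b (k + M) (\<lambda>y. xi y ^ k * f y) \<longleftrightarrow> expandable b M f"
proof
  assume "expandable b M f"
  then obtain q where "(\<lambda>y. f y - rpoly q (xi y)) \<in> err b M"
    by (auto simp: expandable_def)
  then have "(\<lambda>y. xi y ^ k * (f y - rpoly q (xi y))) \<in> err b (k + M)"
    by (simp add: err_shift)
  then show "expandable b (k + M) (\<lambda>y. xi y ^ k * f y)"
    unfolding expandable_def by (intro exI[of _ "monom 1 k * q"]) (simp add: algebra_simps)
next
  assume "expandable b (k + M) (\<lambda>y. xi y ^ k * f y)"
  then obtain q where q: "(\<lambda>y. xi y ^ k * f y - rpoly q (xi y)) \<in> err b (k + M)"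
    by (auto simp: expandable_def)
  have "(\<lambda>y. xi y ^ k * f y) \<in> O[at_infinity](\<lambda>y. xi y ^ k)"
    using landau_o.big.mult_left[OF bdd, of "\<lambda>y. xi y ^ k"] by simp
  from sum_in_bigo(2)[OF this err_bigo[OF q, of k]]
  have "(\<lambda>y. rpoly q (xi y)) \<in> O[at_infinity](\<lambda>y. xi y ^ k)" by simp
  then obtain r where r: "q = monom 1 k * r" using rpoly_xi_bigo_dvd by blast
  have "(\<lambda>y. xi y ^ k * (f y - rpoly r (xi y))) \<in> err b (k + M)"
    using q by (simp add: r algebra_simps)
  then show "expandable b M f" unfolding err_shift expandable_def by blast
qed

text \<open>Reversing both polynomials turns the fraction into one in 1 / z. The new denominator has
  the leading coefficient of r as constant term, and the degree condition leaves a nonnegative power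
  of 1 / z in the numerator.\<close>

lemma expandable_rational:
  assumes deg: "degree q \<le> degree r" and r: "r \<noteq> 0" and M: "M \<ge> 1"
  shows "expandable b M (\<lambda>y. rpoly q (\<i> * of_real y) / rpoly r (\<i> * of_real y))"
proof -
  define f where "f = (\<lambda>y. rpoly (monom 1 (degree r - degree q) * reflect_poly q) (xi y)
    / rpoly (reflect_poly r) (xi y))"
  have "expandable b M f"
    unfolding f_def using r M
    by (intro expandable_divide_rpoly expandable_rpoly) (simp_all add: coeff_reflect_poly)
  moreover have "\<forall>\<^sub>F y in at_infinity. f y = rpoly q (\<i> * of_real y) / rpoly r (\<i> * of_real y)"
    using xi_nonzero
  proof eventually_elim
    case (elim y)
    define z where "z = \<i> * complex_of_real y"
    have z: "z \<noteq> 0" and xi: "xi y = 1 / z"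
      using elim by (auto simp: xi_def z_def)
    have "z ^ degree r = z ^ (degree r - degree q) * z ^ degree q"
      using deg by (simp flip: power_add)
    then show ?case
      unfolding f_def z_def[symmetric] rpoly_reflect_poly[OF z, of q, symmetric]
        rpoly_reflect_poly[OF z, of r, symmetric] xi
      using z by (simp add: power_divide field_simps)
  qed
  ultimately show ?thesis
    by (simp add: expandable_cong)
qed

text \<open>Property \<open>(j\<^sub>q)\<close> allows an error \<open>o(z\<^bsup>-M\<^esup>)\<close>, or \<open>O(z\<^bsup>-M\<^esup>)\<close> if \<open>j = 2\<close>, where
  \<open>M = order_index j q\<close>.\<close>
definition order_index :: "nat \<Rightarrow> nat \<Rightarrow> nat" where
  "order_index j q = (if j = 1 then 2 * q + 1 else 2 * q + 2)"

lemma asymptotic_sum_rpoly: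
  "asymptotic_sum s N (\<i> * of_real y) = rpoly (- (\<Sum>i\<le>N. monom (s i) (i + 1))) (xi y)"
  by (simp add: asymptotic_sum_def xi_def power_divide)

lemma has_expansion_err:
  assumes "j \<in> {1, 2, 3}"
  shows "has_expansion j q m s \<longleftrightarrow>
    (\<lambda>y. m (\<i> * of_real y) - asymptotic_sum s (2 * q + (if j = 3 then 1 else 0)) (\<i> * of_real y))
      \<in> err (j \<noteq> 2) (order_index j q)"
  using assms by (auto simp: has_expansion_def err_def order_index_def xi_def power_divide)

text \<open>Translates between the prescribed number of terms and an approximant of arbitrary
  degree. The limit 0 removes the constant term, which \<open>asymptotic_sum\<close> does not
  have.\<close>

lemma has_property_iff_expandable:
  assumes j: "j \<in> {1, 2, 3}" and lim: "((\<lambda>y::real. m (\<i> * of_real y)) \<longlongrightarrow> 0) at_infinity"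
  shows "has_property j q m \<longleftrightarrow> expandable (j \<noteq> 2) (order_index j q) (\<lambda>y. m (\<i> * of_real y))"
proof
  assume "has_property j q m"
  then show "expandable (j \<noteq> 2) (order_index j q) (\<lambda>y. m (\<i> * of_real y))"
    unfolding has_property_def has_expansion_err[OF j] asymptotic_sum_rpoly expandable_def by blast
next
  define N where "N = 2 * q + (if j = 3 then 1 else 0)"
  assume "expandable (j \<noteq> 2) (order_index j q) (\<lambda>y. m (\<i> * of_real y))"
  then obtain r where r: "(\<lambda>y. m (\<i> * of_real y) - rpoly r (xi y)) \<in> err (j \<noteq> 2) (order_index j q)"
    by (auto simp: expandable_def)
  have "((\<lambda>y. m (\<i> * of_real y) - (m (\<i> * of_real y) - rpoly r (xi y))) \<longlongrightarrow> 0 - 0) at_infinity"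
    by (intro tendsto_diff lim err_tendsto[OF r]) (simp add: order_index_def)
  then have "((\<lambda>y. rpoly r (xi y)) \<longlongrightarrow> 0) at_infinity" by simp
  from tendsto_unique[OF trivial_limit_at_infinity this tendsto_rpoly_xi] have r0: "coeff r 0 = 0" by simp
  \<comment> \<open>Sign and index shift come from \<open>asymptotic_sum\<close>, where
    \<open>s i\<close> belongs to - 1 / z^(i + 1).\<close>
  define s where "s = (\<lambda>i. - coeff r (i + 1))"
  define h where "h = r + (\<Sum>i\<le>N. monom (s i) (i + 1))"
  have "\<exists>g. h = monom 1 (N + 2) * g"
  proof -
    have "coeff h i = 0" if "i < N + 2" for i
    proof (cases i)
      case 0
      then show ?thesis using r0 by (simp add: h_def coeff_sum)
    next
      case (Suc l)
      then have "coeff h i = coeff r (Suc l) + (\<Sum>k\<le>N. if k = l then s k else 0)"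
        by (auto simp: h_def coeff_sum intro!: sum.cong)
      also have "\<dots> = 0" using that Suc by (simp add: s_def)
      finally show ?thesis .
    qed
    then show ?thesis using monom_1_dvd_iff'[of "N + 2" h] by (auto elim: dvdE)
  qed
  then obtain g where g: "h = monom 1 (N + 2) * g" by blast
  \<comment> \<open>The exponent N + 2 exceeds the order for j = 1 and j = 3; for j = 2 it equals
    the order, which is enough for an O error.\<close>
  have "(\<lambda>y. xi y ^ (N + 2)) \<in> err (j \<noteq> 2) (order_index j q)"
    by (rule bigo_in_err[of _ "N + 2"]) (use j in \<open>auto simp: N_def order_index_def\<close>)
  from err_mult[OF rpoly_xi_bounded this, of g]
  have "(\<lambda>y. rpoly h (xi y)) \<in> err (j \<noteq> 2) (order_index j q)"
    by (simp add: g mult.commute)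
  from err_add[OF r this] have "has_expansion j q m s"
    unfolding has_expansion_err[OF j] N_def[symmetric] asymptotic_sum_rpoly
    by (simp add: h_def)
  then show "has_property j q m" by (auto simp: has_property_def)
qed

section \<open>Square integrable functions and the multiplication operator\<close>

text \<open>Complementary to \<open>rpoly\<close>: complex coefficients, real argument. These are
  the polynomials as elements of L2; division by t - z at a nonreal z forces complex
  coefficients.\<close>

definition pval :: "complex poly \<Rightarrow> real \<Rightarrow> complex" where
  "pval q t = poly q (of_real t)"

lemma pval_simps [simp]:
  "pval 0 t = 0" "pval 1 t = 1" "pval (pCons a q) t = a + of_real t * pval q t"
  "pval (q + r) t = pval q t + pval r t" "pval (q - r) t = pval q t - pval r t"
  "pval (q * r) t = pval q t * pval r t" "pval (Polynomial.smult a q) t = a * pval q t"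
  "pval (monom a k) t = a * of_real t ^ k"
  by (simp_all add: pval_def poly_monom)

lemma pval_measurable [measurable]: "pval q \<in> borel_measurable borel"
  unfolding pval_def
  by (intro borel_measurable_continuous_onI continuous_intros)

lemma cnj_measurable [measurable]: "cnj \<in> borel_measurable borel"
  by (intro borel_measurable_continuous_onI continuous_intros)

lemma cnj_pval: "cnj (pval q t) = pval (map_poly cnj q) t"
  by (simp add: pval_def poly_map_poly_cnj)

lemma pval_of_real_poly: "pval (map_poly complex_of_real q) t = of_real (poly q t)"
  using rpoly_of_real[of q t] by (simp add: pval_def rpoly_def)

text \<open>The quotient is (q(t) - q(z)) / (t - z), a polynomial in t. It lets an integral of a
  polynomial against the Cauchy kernel be split into a moment part and a multiple of a simpler
  transform.\<close>

lemma pval_synthetic_div: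
  "(of_real t - z) * pval (synthetic_div q z) t = pval q t - poly q z"
proof -
  have "poly ([:- z, 1:] * synthetic_div q z + [:poly q z:]) (of_real t) = pval q t"
    by (simp only: synthetic_div_correct' pval_def)
  then show ?thesis by (simp add: pval_def algebra_simps)
qed

lemma coeff_synthetic_div:
  assumes "degree q \<le> Suc k"
  shows "coeff (synthetic_div q z) k = coeff q (Suc k)"
proof -
  have "coeff (synthetic_div q z) (Suc k) = 0"
    using assms by (intro coeff_eq_0) (simp add: degree_synthetic_div)
  then show ?thesis
    using arg_cong[OF synthetic_div_correct[of q z], of "\<lambda>q. coeff q (Suc k)"] by simp
qed

section \<open>The Cauchy kernel\<close>

definition kern :: "complex \<Rightarrow> real \<Rightarrow> complex" where
  "kern z t = 1 / (of_real t - z)"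

lemma kern_mult:
  assumes "z \<notin> \<real>"
  shows "(of_real t - z) * kern z t = 1"
proof -
  have "of_real t \<noteq> z" using assms by auto
  then show ?thesis by (simp add: kern_def)
qed

lemma kern_mult_t: "z \<notin> \<real> \<Longrightarrow> of_real t * kern z t = 1 + z * kern z t"
  using kern_mult[of z t] by (simp add: algebra_simps)

lemma kern_measurable [measurable]: "kern z \<in> borel_measurable borel"
  unfolding kern_def by measurable

lemma kern_bound:
  assumes "z \<notin> \<real>"
  shows "cmod (kern z t) \<le> 1 / \<bar>Im z\<bar>"
proof -
  have "\<bar>Im z\<bar> \<le> cmod (of_real t - z)"
    using abs_Im_le_cmod[of "of_real t - z"] by simp
  moreover have "\<bar>Im z\<bar> > 0" using assms by (simp add: complex_is_Real_iff)
  ultimately show ?thesis by (simp add: kern_def norm_divide frac_le)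
qed

lemma Im_complex_of_real_mult: "Im (of_real x * z) = x * Im z"
  by simp

lemma kern_cnj: "kern (cnj z) t = cnj (kern z t)"
  by (simp add: kern_def)

lemma Im_kern: "Im (kern z t) = Im z * (cmod (kern z t))\<^sup>2"
  by (simp add: kern_def Im_divide cmod_power2 norm_divide power_divide)

lemma pval_synthetic_div_kern:
  assumes "z \<notin> \<real>"
  shows "pval (synthetic_div q z) t = (pval q t - poly q z) * kern z t"
  using pval_synthetic_div[of t z q] kern_mult[OF assms, of t]
  by (metis mult.assoc mult.commute mult.right_neutral)

lemma app_graph: "(f, g) \<in> T \<Longrightarrow> (f, app T f) \<in> T"
  unfolding app_def by (rule someI[of "\<lambda>g. (f, g) \<in> T"])

lemma resolventI:
  assumes "(f, g) \<in> T" "\<And>t. x t + z * f t = g t"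
  shows "(x, f) \<in> resolvent T z"
proof -
  have "x = (\<lambda>t. g t - z * f t)" using assms(2)[symmetric] by auto
  then show ?thesis using assms(1) by (auto simp: resolvent_def)
qed

locale finite_borel_measure = finite_measure \<sigma> for \<sigma> :: "real measure" +
  assumes sets_eq [measurable_cong]: "sets \<sigma> = sets borel"
begin

lemma measurable_eq: "borel_measurable \<sigma> = borel_measurable borel"
  by (rule measurable_cong_sets) (simp_all add: sets_eq)

lemma L2_measurable: "f \<in> L2 \<sigma> \<Longrightarrow> f \<in> borel_measurable borel"
  by (simp add: L2_def measurable_eq)

lemma L2_AE:
  assumes f: "f \<in> L2 \<sigma>" and g [measurable]: "g \<in> borel_measurable borel"
    and ae: "AE t in \<sigma>. cmod (g t) \<le> C * cmod (f t)"
  shows "g \<in> L2 \<sigma>"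
proof -
  have int: "integrable \<sigma> (\<lambda>t. C\<^sup>2 * (cmod (f t))\<^sup>2)" using f by (simp add: L2_def)
  have le: "AE t in \<sigma>. norm ((cmod (g t))\<^sup>2) \<le> norm (C\<^sup>2 * (cmod (f t))\<^sup>2)"
    using ae
  proof eventually_elim
    case (elim t)
    have "(cmod (g t))\<^sup>2 \<le> (C * cmod (f t))\<^sup>2"
      using elim by (rule power_mono) simp
    then show ?case by (simp add: power_mult_distrib)
  qed
  have "integrable \<sigma> (\<lambda>t. (cmod (g t))\<^sup>2)"
    by (rule Bochner_Integration.integrable_bound[OF int _ le]) measurable
  then show ?thesis by (simp add: L2_def measurable_eq)
qed

lemma L2_cong_AE:
  assumes "f \<in> L2 \<sigma>" "g \<in> borel_measurable borel" "AE t in \<sigma>. g t = f t"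
  shows "g \<in> L2 \<sigma>"
proof (rule L2_AE[OF assms(1,2), where C = 1])
  show "AE t in \<sigma>. cmod (g t) \<le> 1 * cmod (f t)" using assms(3) by eventually_elim simp
qed

lemma L2_add:
  assumes "f \<in> L2 \<sigma>" "g \<in> L2 \<sigma>"
  shows "(\<lambda>t. f t + g t) \<in> L2 \<sigma>"
proof -
  have [measurable]: "f \<in> borel_measurable borel" "g \<in> borel_measurable borel"
    using assms L2_measurable by auto
  have int: "integrable \<sigma> (\<lambda>t. 2 * (cmod (f t))\<^sup>2 + 2 * (cmod (g t))\<^sup>2)"
    using assms by (simp add: L2_def)
  have le: "(cmod (f t + g t))\<^sup>2 \<le> 2 * (cmod (f t))\<^sup>2 + 2 * (cmod (g t))\<^sup>2" for t
  proof -
    have "(cmod (f t + g t))\<^sup>2 \<le> (cmod (f t) + cmod (g t))\<^sup>2"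
      by (intro power_mono norm_triangle_ineq) simp
    then show ?thesis
      using sum_squares_bound[of "cmod (f t)" "cmod (g t)"] by (simp add: power2_sum)
  qed
  have "integrable \<sigma> (\<lambda>t. (cmod (f t + g t))\<^sup>2)"
  proof (rule Bochner_Integration.integrable_bound[OF int])
    show "AE t in \<sigma>. norm ((cmod (f t + g t))\<^sup>2) \<le> norm (2 * (cmod (f t))\<^sup>2 + 2 * (cmod (g t))\<^sup>2)"
      by (intro AE_I2) (use le in simp)
  qed measurable
  then show ?thesis by (simp add: L2_def measurable_eq)
qed

lemma L2_scale: "f \<in> L2 \<sigma> \<Longrightarrow> (\<lambda>t. c * f t) \<in> L2 \<sigma>"
proof (rule L2_AE[of f _ "cmod c"])
  assume "f \<in> L2 \<sigma>"
  then have [measurable]: "f \<in> borel_measurable borel" by (rule L2_measurable)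
  show "(\<lambda>t. c * f t) \<in> borel_measurable borel" by measurable
qed (simp_all add: norm_mult)

lemma L2_uminus: "f \<in> L2 \<sigma> \<Longrightarrow> (\<lambda>t. - f t) \<in> L2 \<sigma>"
  using L2_scale[of f "- 1"] by simp

lemma L2_diff: "f \<in> L2 \<sigma> \<Longrightarrow> g \<in> L2 \<sigma> \<Longrightarrow> (\<lambda>t. f t - g t) \<in> L2 \<sigma>"
  using L2_add[of f "\<lambda>t. - g t"] L2_uminus[of g] by simp

lemma L2_cnj: "f \<in> L2 \<sigma> \<Longrightarrow> (\<lambda>t. cnj (f t)) \<in> L2 \<sigma>"
proof (rule L2_AE[of f _ 1])
  assume "f \<in> L2 \<sigma>"
  then have [measurable]: "f \<in> borel_measurable borel" by (rule L2_measurable)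
  show "(\<lambda>t. cnj (f t)) \<in> borel_measurable borel" by measurable
qed simp_all

lemma L2_kern: "z \<notin> \<real> \<Longrightarrow> f \<in> L2 \<sigma> \<Longrightarrow> (\<lambda>t. f t * kern z t) \<in> L2 \<sigma>"
proof (rule L2_AE[of f _ "1 / \<bar>Im z\<bar>"])
  assume "z \<notin> \<real>" "f \<in> L2 \<sigma>"
  then have [measurable]: "f \<in> borel_measurable borel" using L2_measurable by auto
  show "(\<lambda>t. f t * kern z t) \<in> borel_measurable borel" by measurable
  show "AE t in \<sigma>. cmod (f t * kern z t) \<le> 1 / \<bar>Im z\<bar> * cmod (f t)"
  proof (intro AE_I2)
    fix t
    show "cmod (f t * kern z t) \<le> 1 / \<bar>Im z\<bar> * cmod (f t)"
      using mult_right_mono[OF kern_bound[OF \<open>z \<notin> \<real>\<close>, of t] norm_ge_zero[of "f t"]]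
      by (simp add: norm_mult mult.commute)
  qed
qed

lemma L2_bounded: "g \<in> borel_measurable borel \<Longrightarrow> (\<And>t. cmod (g t) \<le> C) \<Longrightarrow> g \<in> L2 \<sigma>"
proof (rule L2_AE[of "\<lambda>t. 1" _ C])
  show "(\<lambda>t. 1) \<in> L2 \<sigma>" by (simp add: L2_def)
qed simp_all

lemma L2_integrable:
  assumes "f \<in> L2 \<sigma>" "g \<in> L2 \<sigma>"
  shows "integrable \<sigma> (\<lambda>t. f t * g t)"
proof -
  have [measurable]: "f \<in> borel_measurable borel" "g \<in> borel_measurable borel"
    using assms L2_measurable by auto
  have int: "integrable \<sigma> (\<lambda>t. (cmod (f t))\<^sup>2 + (cmod (g t))\<^sup>2)"
    using assms by (simp add: L2_def)
  have le: "cmod (f t * g t) \<le> (cmod (f t))\<^sup>2 + (cmod (g t))\<^sup>2" for t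
    using sum_squares_bound[of "cmod (f t)" "cmod (g t)"]
      mult_nonneg_nonneg[OF norm_ge_zero[of "f t"] norm_ge_zero[of "g t"]]
    unfolding norm_mult by linarith
  show ?thesis
  proof (rule Bochner_Integration.integrable_bound[OF int])
    show "AE t in \<sigma>. norm (f t * g t) \<le> norm ((cmod (f t))\<^sup>2 + (cmod (g t))\<^sup>2)"
      by (intro AE_I2) (use le in simp)
  qed measurable
qed

lemma L2_integral_cong:
  assumes "f \<in> L2 \<sigma>" "g \<in> L2 \<sigma>" "h \<in> L2 \<sigma>" "AE t in \<sigma>. f t = g t"
  shows "(\<integral>t. f t * h t \<partial>\<sigma>) = (\<integral>t. g t * h t \<partial>\<sigma>)"
proof -
  have [measurable]: "f \<in> borel_measurable borel" "g \<in> borel_measurable borel"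
      "h \<in> borel_measurable borel"
    using assms L2_measurable by auto
  show ?thesis by (rule integral_cong_AE) (use assms(4) in auto)
qed

lemma L2_norm_zero:
  assumes "f \<in> L2 \<sigma>" "(\<integral>t. (cmod (f t))\<^sup>2 \<partial>\<sigma>) = 0"
  shows "AE t in \<sigma>. f t = 0"
  using assms integral_nonneg_eq_0_iff_AE[of \<sigma> "\<lambda>t. (cmod (f t))\<^sup>2"] by (simp add: L2_def)

lemma integral_norm_sq: "(\<integral>t. f t * cnj (f t) \<partial>\<sigma>) = of_real (\<integral>t. (cmod (f t))\<^sup>2 \<partial>\<sigma>)"
  unfolding complex_norm_square[symmetric] by (rule integral_complex_of_real)

lemma L2_orthogonal_self:
  assumes "f \<in> L2 \<sigma>" "ip \<sigma> f f = 0"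
  shows "AE t in \<sigma>. f t = 0"
proof (rule L2_norm_zero[OF assms(1)])
  show "(\<integral>t. (cmod (f t))\<^sup>2 \<partial>\<sigma>) = 0"
    using assms(2) by (simp add: ip_def integral_norm_sq)
qed

lemma ip_add: "f \<in> L2 \<sigma> \<Longrightarrow> g \<in> L2 \<sigma> \<Longrightarrow> h \<in> L2 \<sigma> \<Longrightarrow>
    ip \<sigma> (\<lambda>t. f t + g t) h = ip \<sigma> f h + ip \<sigma> g h"
  using L2_integrable[of f "\<lambda>t. cnj (h t)"] L2_integrable[of g "\<lambda>t. cnj (h t)"]
  by (simp add: ip_def distrib_right L2_cnj)

lemma ip_diff: "f \<in> L2 \<sigma> \<Longrightarrow> g \<in> L2 \<sigma> \<Longrightarrow> h \<in> L2 \<sigma> \<Longrightarrow>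
    ip \<sigma> (\<lambda>t. f t - g t) h = ip \<sigma> f h - ip \<sigma> g h"
  using L2_integrable[of f "\<lambda>t. cnj (h t)"] L2_integrable[of g "\<lambda>t. cnj (h t)"]
  by (simp add: ip_def left_diff_distrib L2_cnj)

lemma ip_scale: "ip \<sigma> (\<lambda>t. c * f t) h = c * ip \<sigma> f h"
  by (simp add: ip_def mult.assoc)

lemma ip_cnj: "ip \<sigma> g f = cnj (ip \<sigma> f g)"
  by (simp add: ip_def mult.commute flip: Bochner_Integration.integral_cnj)

lemma ip_cong_AE:
  assumes "f \<in> L2 \<sigma>" "g \<in> L2 \<sigma>" "h \<in> L2 \<sigma>" "AE t in \<sigma>. f t = g t"
  shows "ip \<sigma> f h = ip \<sigma> g h"
  unfolding ip_def by (rule L2_integral_cong[OF assms(1,2) L2_cnj[OF assms(3)] assms(4)])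

text \<open>Taking imaginary parts: \<open>Im (t - z)\<close> and \<open>Im (kern z t)\<close> have constant sign.\<close>

lemma multiplication_form_zero:
  assumes f: "f \<in> L2 \<sigma>" and tf: "(\<lambda>t. of_real t * f t) \<in> L2 \<sigma>" and z: "z \<notin> \<real>"
    and zero: "ip \<sigma> (\<lambda>t. of_real t * f t - z * f t) f = 0"
  shows "AE t in \<sigma>. f t = 0"
proof (rule L2_orthogonal_self[OF f])
  have "ip \<sigma> (\<lambda>t. of_real t * f t) f = of_real (\<integral>t. t * (cmod (f t))\<^sup>2 \<partial>\<sigma>)"
    unfolding ip_def integral_complex_of_real[symmetric]
    by (intro Bochner_Integration.integral_cong refl)
      (simp only: mult.assoc complex_norm_square[symmetric] of_real_mult)
  moreover have "ip \<sigma> (\<lambda>t. of_real t * f t) f = z * of_real (\<integral>t. (cmod (f t))\<^sup>2 \<partial>\<sigma>)"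
    using zero ip_diff[OF tf L2_scale[OF f, of z] f]
    by (simp add: ip_scale) (simp add: ip_def integral_norm_sq)
  ultimately have "of_real (\<integral>t. t * (cmod (f t))\<^sup>2 \<partial>\<sigma>)
      = z * of_real (\<integral>t. (cmod (f t))\<^sup>2 \<partial>\<sigma>)" by simp
  from arg_cong[OF this, of Im] have "Im z * (\<integral>t. (cmod (f t))\<^sup>2 \<partial>\<sigma>) = 0"
    by simp
  then show "ip \<sigma> f f = 0"
    using z by (simp add: ip_def integral_norm_sq complex_is_Real_iff)
qed

lemma kern_form_nonzero:
  assumes f: "f \<in> L2 \<sigma>" and z: "z \<notin> \<real>"
    and zero: "(\<integral>t. f t * cnj (f t) * kern z t \<partial>\<sigma>) = 0"
  shows "ip \<sigma> f f = 0"
proof -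
  have [measurable]: "f \<in> borel_measurable borel" using f L2_measurable by auto
  have g: "(\<lambda>t. f t * kern z t) \<in> L2 \<sigma>" by (rule L2_kern[OF z f])
  have int: "integrable \<sigma> (\<lambda>t. f t * cnj (f t) * kern z t)"
    using L2_integrable[OF g L2_cnj[OF f]] by (simp add: mult_ac)
  have "Im z * (\<integral>t. (cmod (f t * kern z t))\<^sup>2 \<partial>\<sigma>)
      = (\<integral>t. Im (f t * cnj (f t) * kern z t) \<partial>\<sigma>)"
    unfolding Bochner_Integration.integral_mult_right_zero[symmetric]
  proof (intro Bochner_Integration.integral_cong refl)
    fix t
    have "f t * cnj (f t) = of_real ((cmod (f t))\<^sup>2)"
      by (rule complex_norm_square[symmetric])
    then show "Im z * (cmod (f t * kern z t))\<^sup>2 = Im (f t * cnj (f t) * kern z t)"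
      by (simp only: Im_complex_of_real_mult Im_kern norm_mult power_mult_distrib)
        (simp only: mult_ac)
  qed
  also have "\<dots> = 0" unfolding integral_Im[OF int] zero by simp
  finally have "(\<integral>t. (cmod (f t * kern z t))\<^sup>2 \<partial>\<sigma>) = 0"
    using z by (simp add: complex_is_Real_iff)
  from L2_norm_zero[OF g this] have "AE t in \<sigma>. f t = 0"
  proof eventually_elim
    case (elim t)
    with kern_mult[OF z, of t] show ?case by auto
  qed
  then have "(\<integral>t. f t * cnj (f t) \<partial>\<sigma>) = (\<integral>t. 0 \<partial>\<sigma>)"
    by (intro integral_cong_AE) auto
  then show ?thesis by (simp add: ip_def)
qed

section \<open>Decay of Cauchy integrals along the imaginary axis\<close>

lemma integral_kern_bound:
  assumes f: "integrable \<sigma> f" and z: "z \<notin> \<real>"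
  shows "cmod (\<integral>t. f t * kern z t \<partial>\<sigma>) \<le> (\<integral>t. cmod (f t) \<partial>\<sigma>) / \<bar>Im z\<bar>"
proof -
  have [measurable]: "f \<in> borel_measurable borel"
    using f measurable_eq by auto
  have le: "cmod (f t * kern z t) \<le> cmod (f t) / \<bar>Im z\<bar>" for t
    using mult_left_mono[OF kern_bound[OF z] norm_ge_zero[of "f t"]] by (simp add: norm_mult)
  have int: "integrable \<sigma> (\<lambda>t. cmod (f t) / \<bar>Im z\<bar>)" using f by simp
  have "integrable \<sigma> (\<lambda>t. f t * kern z t)"
  proof (rule Bochner_Integration.integrable_bound[OF int])
    show "AE t in \<sigma>. norm (f t * kern z t) \<le> norm (cmod (f t) / \<bar>Im z\<bar>)"
      by (intro AE_I2) (use le in simp)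
  qed measurable
  from Bochner_Integration.integral_norm_bound_integral[OF this int] le show ?thesis by simp
qed

lemma integral_kern_tendsto:
  assumes f: "integrable \<sigma> f"
  shows "((\<lambda>y. \<integral>t. f t * kern (\<i> * of_real y) t \<partial>\<sigma>) \<longlongrightarrow> 0) at_infinity"
proof (rule Lim_null_comparison)
  show "\<forall>\<^sub>F y in at_infinity. cmod (\<integral>t. f t * kern (\<i> * of_real y) t \<partial>\<sigma>)
      \<le> (\<integral>t. cmod (f t) \<partial>\<sigma>) * cmod (xi y)"
    using xi_nonzero
  proof eventually_elim
    case (elim y)
    then have "\<i> * complex_of_real y \<notin> \<real>"
      by (auto simp: xi_def complex_is_Real_iff)
    from integral_kern_bound[OF f this] show ?case
      by (simp add: xi_def norm_divide norm_mult)
  qed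
  show "((\<lambda>y. (\<integral>t. cmod (f t) \<partial>\<sigma>) * cmod (xi y)) \<longlongrightarrow> 0) at_infinity"
    using tendsto_mult[OF tendsto_const tendsto_norm[OF tendsto_xi]] by simp
qed

text \<open>Away from a compact interval \<open>r / q\<close> is bounded.\<close>
lemma L2_pval_degree_mono:
  assumes q: "pval q \<in> L2 \<sigma>" and q0: "q \<noteq> 0" and deg: "degree r \<le> degree q"
  shows "pval r \<in> L2 \<sigma>"
proof -
  have lead: "(\<lambda>z. z ^ degree q) \<in> O[at_infinity](poly q)"
  proof (rule landau_o.bigI)
    have "((\<lambda>z. poly q z / z ^ degree q) \<longlongrightarrow> lead_coeff q) at_infinity"
      by (rule poly_divide_tendsto_aux)
    from tendsto_norm[OF this] have "\<forall>\<^sub>F z in at_infinity. norm (poly q z / z ^ degree q) > norm (lead_coeff q) / 2"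
      by (rule order_tendstoD) (use q0 in simp)
    moreover have "\<forall>\<^sub>F z::complex in at_infinity. z \<noteq> 0"
      unfolding eventually_at_infinity by (intro exI[of _ 1]) auto
    ultimately show "\<forall>\<^sub>F z in at_infinity. norm (z ^ degree q) \<le> (2 / norm (lead_coeff q)) * norm (poly q z)"
      by eventually_elim (use q0 in \<open>simp add: norm_divide field_simps\<close>)
  qed (use q0 in simp)
  have "poly r \<in> O[at_infinity](\<lambda>z. z ^ degree q)"
  proof (cases "r = 0")
    case False
    have "((\<lambda>z. poly r z / z ^ degree r) \<longlongrightarrow> lead_coeff r) at_infinity"
      by (rule poly_divide_tendsto_aux)
    moreover have nz: "\<forall>\<^sub>F z::complex in at_infinity. z ^ degree r \<noteq> 0"
      unfolding eventually_at_infinity by (intro exI[of _ 1]) auto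
    ultimately have "poly r \<in> O[at_infinity](\<lambda>z. z ^ degree r)"
      by (rule bigoI_tendsto)
    moreover have "(\<lambda>z::complex. z ^ degree r) \<in> O[at_infinity](\<lambda>z. z ^ degree q)"
    proof (rule landau_o.bigI[of 1])
      show "\<forall>\<^sub>F z::complex in at_infinity. norm (z ^ degree r) \<le> 1 * norm (z ^ degree q)"
        unfolding eventually_at_infinity
        by (intro exI[of _ 1]) (use deg in \<open>auto simp: norm_power intro: power_increasing\<close>)
    qed simp
    ultimately show ?thesis by (rule landau_o.big_trans)
  next
    case True
    then have "poly r = (\<lambda>_. 0)" by auto
    then show ?thesis by simp
  qed
  from landau_o.big_trans[OF this lead] obtain C where C: "C > 0"
    and ev: "\<forall>\<^sub>F z in at_infinity. norm (poly r z) \<le> C * norm (poly q z)"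
    by (rule landau_o.bigE)
  from ev obtain R where R: "norm (poly r z) \<le> C * norm (poly q z)" if "norm z \<ge> R" for z
    unfolding eventually_at_infinity by blast
  have "compact (poly r ` cball 0 R)"
    by (intro compact_continuous_image continuous_intros) auto
  then obtain B where B: "norm (poly r z) \<le> B" if "norm z \<le> R" for z
    using compact_imp_bounded bounded_iff by (metis image_eqI mem_cball_0)
  have "(\<lambda>t. of_real (C * cmod (pval q t)) + of_real \<bar>B\<bar>) \<in> L2 \<sigma>"
  proof (rule L2_add)
    show "(\<lambda>t. complex_of_real (C * cmod (pval q t))) \<in> L2 \<sigma>"
      by (rule L2_AE[OF q, of _ C]) (use C in \<open>auto simp: norm_mult\<close>)
    show "(\<lambda>t. complex_of_real \<bar>B\<bar>) \<in> L2 \<sigma>"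
      by (rule L2_bounded[of _ "\<bar>B\<bar>"]) auto
  qed
  then show ?thesis
  proof (rule L2_AE[where C = 1])
    have "cmod (pval r t) \<le> C * cmod (pval q t) + \<bar>B\<bar>" for t
    proof (cases "norm (complex_of_real t) \<ge> R")
      case True
      from R[OF this] show ?thesis by (simp add: pval_def)
    next
      case False
      then have "norm (poly r (of_real t)) \<le> B" by (intro B) simp
      moreover have "C * cmod (pval q t) \<ge> 0" using C by simp
      ultimately show ?thesis by (simp add: pval_def)
    qed
    moreover have "cmod (of_real (C * cmod (pval q t)) + complex_of_real \<bar>B\<bar>)
        = C * cmod (pval q t) + \<bar>B\<bar>" for t
      unfolding of_real_add[symmetric] norm_of_real using C by simp
    ultimately show "AE t in \<sigma>. cmod (pval r t)
        \<le> 1 * cmod (of_real (C * cmod (pval q t)) + complex_of_real \<bar>B\<bar>)"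
      by (simp only: mult_1 eventually_True always_eventually)
  qed simp
qed

text \<open>The difference f of two solutions lies in K, and what the projection removes is
  orthogonal to K, in particular to f. Hence ((t - z) f, f) = 0, which forces f = 0 almost
  everywhere.\<close>

lemma resolvent_compression_unique:
  assumes K: "K \<subseteq> L2 \<sigma>" and Kdiff: "\<And>f g. f \<in> K \<Longrightarrow> g \<in> K \<Longrightarrow> (\<lambda>t. f t - g t) \<in> K"
    and z: "z \<notin> \<real>"
    and 1: "(x, f\<^sub>1) \<in> resolvent (compression \<sigma> (mult_op \<sigma>) K) z"
    and 2: "(x, f\<^sub>2) \<in> resolvent (compression \<sigma> (mult_op \<sigma>) K) z"
  shows "AE t in \<sigma>. f\<^sub>1 t = f\<^sub>2 t"
proof -
  from 1 obtain g\<^sub>1 h\<^sub>1 where r1: "x = (\<lambda>t. g\<^sub>1 t - z * f\<^sub>1 t)" "f\<^sub>1 \<in> K" "h\<^sub>1 \<in> L2 \<sigma>"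
      "AE t in \<sigma>. h\<^sub>1 t = of_real t * f\<^sub>1 t" "(\<lambda>t. h\<^sub>1 t - g\<^sub>1 t) \<in> ortho \<sigma> K"
    by (auto simp: resolvent_def compression_def mult_op_def proj_def)
  from 2 obtain g\<^sub>2 h\<^sub>2 where r2: "x = (\<lambda>t. g\<^sub>2 t - z * f\<^sub>2 t)" "f\<^sub>2 \<in> K" "h\<^sub>2 \<in> L2 \<sigma>"
      "AE t in \<sigma>. h\<^sub>2 t = of_real t * f\<^sub>2 t" "(\<lambda>t. h\<^sub>2 t - g\<^sub>2 t) \<in> ortho \<sigma> K"
    by (auto simp: resolvent_def compression_def mult_op_def proj_def)
  define f where "f = (\<lambda>t. f\<^sub>1 t - f\<^sub>2 t)"
  have fK: "f \<in> K" unfolding f_def using r1 r2 Kdiff by auto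
  then have f: "f \<in> L2 \<sigma>" using K by auto
  then have [measurable]: "f \<in> borel_measurable borel" by (rule L2_measurable)
  have h: "(\<lambda>t. h\<^sub>1 t - h\<^sub>2 t) \<in> L2 \<sigma>" using r1 r2 L2_diff by auto
  have ae: "AE t in \<sigma>. of_real t * f t = h\<^sub>1 t - h\<^sub>2 t"
    using r1(4) r2(4) by eventually_elim (simp add: f_def algebra_simps)
  have tf: "(\<lambda>t. of_real t * f t) \<in> L2 \<sigma>"
    by (rule L2_cong_AE[OF h _ ae]) measurable
  have g: "g\<^sub>1 t - g\<^sub>2 t = z * f t" for t
  proof -
    have "g\<^sub>1 t - z * f\<^sub>1 t = g\<^sub>2 t - z * f\<^sub>2 t"
      using fun_cong[OF trans[OF r1(1)[symmetric] r2(1)], of t] by simp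
    then show ?thesis unfolding f_def by (simp add: algebra_simps)
  qed
  have o1: "(\<lambda>t. h\<^sub>1 t - g\<^sub>1 t) \<in> L2 \<sigma>" "ip \<sigma> (\<lambda>t. h\<^sub>1 t - g\<^sub>1 t) f = 0"
    and o2: "(\<lambda>t. h\<^sub>2 t - g\<^sub>2 t) \<in> L2 \<sigma>" "ip \<sigma> (\<lambda>t. h\<^sub>2 t - g\<^sub>2 t) f = 0"
    using r1(5) r2(5) fK by (auto simp: ortho_def)
  have "ip \<sigma> (\<lambda>t. of_real t * f t - z * f t) f = ip \<sigma> (\<lambda>t. (h\<^sub>1 t - g\<^sub>1 t) - (h\<^sub>2 t - g\<^sub>2 t)) f"
  proof (rule ip_cong_AE)
    show "AE t in \<sigma>. of_real t * f t - z * f t = (h\<^sub>1 t - g\<^sub>1 t) - (h\<^sub>2 t - g\<^sub>2 t)"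
      using ae by eventually_elim (simp add: g[symmetric])
  qed (intro L2_diff L2_scale tf f o1 o2)+
  also have "\<dots> = 0" using ip_diff[OF o1(1) o2(1) f] o1 o2 by simp
  finally have "AE t in \<sigma>. f t = 0" by (rule multiplication_form_zero[OF f tf z])
  then show ?thesis by (simp add: f_def)
qed

text \<open>Makes the arbitrary choice in \<open>app\<close> harmless: any one solution of the
  resolvent equation may be used to evaluate the inner product.\<close>

lemma ip_app_resolvent_compression:
  assumes K: "K \<subseteq> L2 \<sigma>" and Kdiff: "\<And>f g. f \<in> K \<Longrightarrow> g \<in> K \<Longrightarrow> (\<lambda>t. f t - g t) \<in> K"
    and z: "z \<notin> \<real>" and f: "(x, f) \<in> resolvent (compression \<sigma> (mult_op \<sigma>) K) z"
    and y: "y \<in> L2 \<sigma>"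
  shows "ip \<sigma> (app (resolvent (compression \<sigma> (mult_op \<sigma>) K) z) x) y = ip \<sigma> f y"
proof -
  define g where "g = app (resolvent (compression \<sigma> (mult_op \<sigma>) K) z) x"
  have g: "(x, g) \<in> resolvent (compression \<sigma> (mult_op \<sigma>) K) z"
    unfolding g_def by (rule app_graph[OF f])
  have "h \<in> K" if "(x, h) \<in> resolvent (compression \<sigma> (mult_op \<sigma>) K) z" for h
    using that by (auto simp: resolvent_def compression_def)
  with f g K have "f \<in> L2 \<sigma>" "g \<in> L2 \<sigma>" by auto
  then have "ip \<sigma> g y = ip \<sigma> f y"
    using ip_cong_AE resolvent_compression_unique[OF K Kdiff z g f] y by blast
  then show ?thesis by (simp add: g_def)
qed

lemma ip_app_resolvent_mult_op:
  assumes z: "z \<notin> \<real>" and x: "x \<in> L2 \<sigma>" and y: "y \<in> L2 \<sigma>"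
  shows "ip \<sigma> (app (resolvent (mult_op \<sigma>) z) x) y = (\<integral>t. x t * cnj (y t) * kern z t \<partial>\<sigma>)"
proof -
  define f where "f = (\<lambda>t. x t * kern z t)"
  have f: "f \<in> L2 \<sigma>" unfolding f_def by (rule L2_kern[OF z x])
  have tf: "x t + z * f t = of_real t * f t" for t
  proof -
    have "x t + z * f t = x t * (1 + z * kern z t)" by (simp add: f_def algebra_simps)
    also have "\<dots> = of_real t * f t"
      unfolding kern_mult_t[OF z, symmetric] by (simp add: f_def mult_ac)
    finally show ?thesis .
  qed
  have "(f, \<lambda>t. x t + z * f t) \<in> mult_op \<sigma>"
    unfolding mult_op_def using f L2_add[OF x L2_scale[OF f, of z]] tf by simp
  then have *: "(x, f) \<in> resolvent (mult_op \<sigma>) z"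
    by (rule resolventI) simp
  define g where "g = app (resolvent (mult_op \<sigma>) z) x"
  have "(x, g) \<in> resolvent (mult_op \<sigma>) z"
    unfolding g_def by (rule app_graph[OF *])
  then obtain h where g: "g \<in> L2 \<sigma>" "x = (\<lambda>t. h t - z * g t)" "AE t in \<sigma>. h t = of_real t * g t"
    by (auto simp: resolvent_def mult_op_def)
  from g(3) have "AE t in \<sigma>. g t = f t"
  proof eventually_elim
    case (elim t)
    then have "f t = (of_real t - z) * kern z t * g t"
      using g(2) by (simp add: f_def algebra_simps)
    then show ?case using kern_mult[OF z, of t] by simp
  qed
  then have "ip \<sigma> g y = ip \<sigma> f y"
    using ip_cong_AE[OF g(1) f y] by blast
  then show ?thesis by (simp add: g_def ip_def f_def mult_ac)
qed

end

section \<open>Orthonormal polynomials and the compression to polynomials\<close>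

lemma pval_sum: "pval (\<Sum>i\<in>I. f i) t = (\<Sum>i\<in>I. pval (f i) t)"
  by (induction I rule: infinite_finite_induct) simp_all

lemma pval_eq_sum:
  assumes "degree q < k"
  shows "pval q t = (\<Sum>i<k. coeff q i * of_real t ^ i)"
  unfolding pval_def poly_altdef
  by (rule sum.mono_neutral_left) (use assms in \<open>auto simp: coeff_eq_0\<close>)

locale orthonormal_polys = finite_borel_measure \<sigma> for \<sigma> :: "real measure" +
  fixes e :: "nat \<Rightarrow> real poly" and p :: nat
  assumes first_kind: "first_kind_polys \<sigma> p e" and p_pos: "p \<ge> 1"
begin

definition E :: "nat \<Rightarrow> complex poly" where
  "E k = map_poly complex_of_real (e k)"

definition lc :: "nat \<Rightarrow> real" where
  "lc k = lead_coeff (e k)"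

text \<open>The recurrence coefficient b_(p-1), read off by comparing the leading coefficients of t
  e_(p-1) and e_p; \<open>ip_app_mult_op_E\<close> confirms it.\<close>

definition \<beta> :: real where
  "\<beta> = lc (p - 1) / lc p"

lemma poly_fun_e: "poly_fun (e k) = pval (E k)"
  by (simp add: fun_eq_iff poly_fun_def E_def pval_of_real_poly)

lemma rpoly_e: "rpoly (e k) z = poly (E k) z"
  by (simp add: rpoly_def E_def)

lemma cnj_E [simp]: "cnj (pval (E k) t) = pval (E k) t"
  by (simp add: E_def pval_of_real_poly)

lemma degree_e: "k \<le> p \<Longrightarrow> degree (e k) = k"
  and lc_pos: "k \<le> p \<Longrightarrow> lc k > 0"
  using first_kind by (auto simp: first_kind_polys_def lc_def)

lemma degree_E: "k \<le> p \<Longrightarrow> degree (E k) = k"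
  by (simp add: E_def degree_map_poly degree_e)

lemma coeff_E: "k \<le> p \<Longrightarrow> coeff (E k) k = of_real (lc k)"
  by (simp add: E_def coeff_map_poly lc_def degree_e)

lemma E_neq_0: "k \<le> p \<Longrightarrow> E k \<noteq> 0"
  using coeff_E[of k] lc_pos[of k] by auto

lemma \<beta>_pos: "\<beta> > 0"
  by (simp add: \<beta>_def lc_pos)

lemma integral_E_E:
  assumes "i \<le> p" "k \<le> p"
  shows "(\<integral>t. pval (E i) t * pval (E k) t \<partial>\<sigma>) = (if i = k then 1 else 0)"
  using first_kind assms by (simp add: first_kind_polys_def ip_def poly_fun_e)

text \<open>The normalization carries the integrability: a nonintegrable function has Bochner
  integral 0, not 1. Square integrability of all polynomials of degree at most p follows from this
  by comparing degrees.\<close>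

lemma E_p_L2: "pval (E p) \<in> L2 \<sigma>"
proof -
  have "of_real (\<integral>t. (cmod (pval (E p) t))\<^sup>2 \<partial>\<sigma>) = (1::complex)"
    using integral_E_E[of p p] unfolding integral_norm_sq[symmetric] by simp
  then have "(\<integral>t. (cmod (pval (E p) t))\<^sup>2 \<partial>\<sigma>) \<noteq> 0" by auto
  then have "integrable \<sigma> (\<lambda>t. (cmod (pval (E p) t))\<^sup>2)"
    using not_integrable_integral_eq by blast
  then show ?thesis by (simp add: L2_def measurable_eq)
qed

lemma pval_L2: "degree q \<le> p \<Longrightarrow> pval q \<in> L2 \<sigma>"
  using L2_pval_degree_mono[OF E_p_L2 E_neq_0] by (simp add: degree_E)

lemma E_L2: "k \<le> p \<Longrightarrow> pval (E k) \<in> L2 \<sigma>"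
  by (simp add: pval_L2 degree_E)

text \<open>A bilinear condition without conjugation, so that polynomial factors can be moved freely
  under the integral. It expresses orthogonality all the same, because conjugating coefficients does
  not raise the degree; see \<open>ortho_span_iff\<close>.\<close>

definition perp :: "nat \<Rightarrow> (real \<Rightarrow> complex) \<Rightarrow> bool" where
  "perp k f \<longleftrightarrow> f \<in> L2 \<sigma> \<and> (\<forall>q. degree q < k \<longrightarrow> (\<integral>t. f t * pval q t \<partial>\<sigma>) = 0)"

lemma perp_basis:
  assumes f: "f \<in> L2 \<sigma>" and k: "k \<le> Suc p"
    and basis: "\<And>i. i < k \<Longrightarrow> (\<integral>t. f t * pval (E i) t \<partial>\<sigma>) = 0"
  shows "perp k f"
proof -
  have "(\<integral>t. f t * pval q t \<partial>\<sigma>) = 0" if "degree q < k" for q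
    using that
  proof (induction "degree q" arbitrary: q rule: less_induct)
    case less
    define m where "m = degree q"
    define c where "c = coeff q m / coeff (E m) m"
    define r where "r = q - Polynomial.smult c (E m)"
    have m: "m < k" "m \<le> p" using less.prems k by (auto simp: m_def)
    have "degree r \<le> m"
      unfolding r_def by (rule degree_diff_le) (use m in \<open>simp_all add: m_def degree_E\<close>)
    moreover have "coeff r m = 0"
      using m lc_pos[of m] by (simp add: r_def c_def coeff_E)
    ultimately have "r = 0 \<or> degree r < m" by (rule eq_zero_or_degree_less)
    then have r0: "(\<integral>t. f t * pval r t \<partial>\<sigma>) = 0"
      using less.hyps[of r] m by (auto simp: m_def)
    have rL: "pval r \<in> L2 \<sigma>" using \<open>degree r \<le> m\<close> m by (intro pval_L2) simp
    have "(\<integral>t. f t * pval q t \<partial>\<sigma>) = (\<integral>t. f t * pval r t + c * (f t * pval (E m) t) \<partial>\<sigma>)"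
      by (rule Bochner_Integration.integral_cong) (simp_all add: r_def algebra_simps)
    also have "\<dots> = 0"
      using L2_integrable[OF f rL] L2_integrable[OF f E_L2[OF m(2)]] r0 basis[OF m(1)] by simp
    finally show ?case .
  qed
  with f show ?thesis by (simp add: perp_def)
qed

lemma perp_E: "k \<le> p \<Longrightarrow> perp k (pval (E k))"
  by (rule perp_basis) (simp_all add: E_L2 integral_E_E)

text \<open>Modulo polynomials of lower degree, which f annihilates, q is a multiple of
  \<open>E k\<close>.\<close>

lemma perp_integral:
  assumes f: "perp k f" and k: "k \<le> p" and deg: "degree q \<le> k"
  shows "(\<integral>t. f t * pval q t \<partial>\<sigma>) = coeff q k / of_real (lc k) * (\<integral>t. f t * pval (E k) t \<partial>\<sigma>)"
proof -
  define c where "c = coeff q k / of_real (lc k)"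
  define r where "r = q - Polynomial.smult c (E k)"
  have "degree r \<le> k"
    unfolding r_def by (rule degree_diff_le) (use k deg in \<open>simp_all add: degree_E\<close>)
  moreover have "coeff r k = 0"
    using k lc_pos[of k] by (simp add: r_def c_def coeff_E)
  ultimately have "r = 0 \<or> degree r < k" by (rule eq_zero_or_degree_less)
  then have r0: "(\<integral>t. f t * pval r t \<partial>\<sigma>) = 0" using f by (auto simp: perp_def)
  have fL: "f \<in> L2 \<sigma>" using f by (simp add: perp_def)
  have rL: "pval r \<in> L2 \<sigma>" using \<open>degree r \<le> k\<close> k by (intro pval_L2) simp
  have "(\<integral>t. f t * pval q t \<partial>\<sigma>) = (\<integral>t. f t * pval r t + c * (f t * pval (E k) t) \<partial>\<sigma>)"
    by (rule Bochner_Integration.integral_cong) (simp_all add: r_def algebra_simps)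
  also have "\<dots> = c * (\<integral>t. f t * pval (E k) t \<partial>\<sigma>)"
    using L2_integrable[OF fL rL] L2_integrable[OF fL E_L2[OF k]] r0 by simp
  finally show ?thesis by (simp add: c_def)
qed

lemma integral_E_pval:
  assumes "k \<le> p" "degree q \<le> k"
  shows "(\<integral>t. pval (E k) t * pval q t \<partial>\<sigma>) = coeff q k / of_real (lc k)"
  using perp_integral[OF perp_E[OF assms(1)] assms] integral_E_E[of k k] assms(1) by simp

section \<open>The polynomial subspace and its orthogonal complement\<close>

lemma poly_span_iff:
  "f \<in> poly_span \<sigma> p \<longleftrightarrow> f \<in> L2 \<sigma> \<and> (\<exists>q. degree q < p \<and> (AE t in \<sigma>. f t = pval q t))"
proof -
  have "(\<exists>c. AE t in \<sigma>. f t = (\<Sum>i<p. c i * of_real t ^ i))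
      \<longleftrightarrow> (\<exists>q. degree q < p \<and> (AE t in \<sigma>. f t = pval q t))" (is "?L \<longleftrightarrow> ?R")
  proof
    assume ?L
    then obtain c where c: "AE t in \<sigma>. f t = (\<Sum>i<p. c i * of_real t ^ i)" by blast
    define q where "q = (\<Sum>i<p. monom (c i) i)"
    have "degree q < p"
      unfolding q_def
      by (rule degree_sum_less) (use p_pos in \<open>auto intro: le_less_trans[OF degree_monom_le]\<close>)
    moreover have "AE t in \<sigma>. f t = pval q t"
      using c by eventually_elim (simp add: q_def pval_sum)
    ultimately show ?R by blast
  next
    assume ?R
    then obtain q where q: "degree q < p" and ae: "AE t in \<sigma>. f t = pval q t" by blast
    from ae have "AE t in \<sigma>. f t = (\<Sum>i<p. coeff q i * of_real t ^ i)"
      by eventually_elim (simp add: pval_eq_sum[OF q])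
    then show ?L by blast
  qed
  then show ?thesis by (simp add: poly_span_def)
qed

lemma pval_in_span: "degree q < p \<Longrightarrow> pval q \<in> poly_span \<sigma> p"
  unfolding poly_span_iff using pval_L2[of q] by auto

lemma span_subset_L2: "poly_span \<sigma> p \<subseteq> L2 \<sigma>"
  by (auto simp: poly_span_def)

lemma span_diff:
  assumes "f \<in> poly_span \<sigma> p" "g \<in> poly_span \<sigma> p"
  shows "(\<lambda>t. f t - g t) \<in> poly_span \<sigma> p"
proof -
  obtain q r where q: "degree q < p" "AE t in \<sigma>. f t = pval q t"
    and r: "degree r < p" "AE t in \<sigma>. g t = pval r t"
    using assms by (auto simp: poly_span_iff)
  have "degree (q - r) < p" using q r by (intro degree_diff_less)
  moreover have "AE t in \<sigma>. f t - g t = pval (q - r) t"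
    using q(2) r(2) by eventually_elim simp
  ultimately show ?thesis
    unfolding poly_span_iff using assms span_subset_L2 by (blast intro: L2_diff)
qed

lemma ip_span:
  assumes f: "f \<in> L2 \<sigma>" and g: "g \<in> L2 \<sigma>" and ae: "AE t in \<sigma>. g t = pval q t" and deg: "degree q < p"
  shows "ip \<sigma> f g = (\<integral>t. f t * pval (map_poly cnj q) t \<partial>\<sigma>)"
proof -
  have qL: "pval q \<in> L2 \<sigma>" using deg by (intro pval_L2) simp
  have "ip \<sigma> f g = cnj (ip \<sigma> (pval q) f)"
    unfolding ip_cnj[of f g] ip_cong_AE[OF g qL f ae] ..
  also have "\<dots> = ip \<sigma> f (pval q)" by (rule ip_cnj[symmetric])
  finally show ?thesis by (simp add: ip_def cnj_pval)
qed

lemma ortho_span_iff: "f \<in> ortho \<sigma> (poly_span \<sigma> p) \<longleftrightarrow> perp p f"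
proof
  assume f: "f \<in> ortho \<sigma> (poly_span \<sigma> p)"
  have "(\<integral>t. f t * pval q t \<partial>\<sigma>) = 0" if q: "degree q < p" for q
  proof -
    have "degree (map_poly cnj q) < p" using q map_poly_degree_leq[of cnj q] by simp
    then have "ip \<sigma> f (pval (map_poly cnj q)) = 0"
      using f pval_in_span by (simp add: ortho_def)
    then show ?thesis by (simp add: ip_def flip: cnj_pval)
  qed
  with f show "perp p f" by (simp add: perp_def ortho_def)
next
  assume f: "perp p f"
  have "ip \<sigma> f g = 0" if g: "g \<in> poly_span \<sigma> p" for g
  proof -
    obtain q where q: "g \<in> L2 \<sigma>" "degree q < p" "AE t in \<sigma>. g t = pval q t"
      using g unfolding poly_span_iff by blast
    have "degree (map_poly cnj q) < p" using q map_poly_degree_leq[of cnj q] by simp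
    with f show ?thesis using ip_span[OF _ q(1,3,2), of f] by (simp add: perp_def)
  qed
  with f show "f \<in> ortho \<sigma> (poly_span \<sigma> p)" by (simp add: ortho_def perp_def)
qed

lemma perp_L2: "perp k f \<Longrightarrow> f \<in> L2 \<sigma>"
  by (simp add: perp_def)

lemma perp_add:
  assumes "perp k f" "perp k g" "k \<le> Suc p"
  shows "perp k (\<lambda>t. f t + g t)"
proof -
  have "(\<integral>t. (f t + g t) * pval q t \<partial>\<sigma>) = 0" if q: "degree q < k" for q
  proof -
    have qL: "pval q \<in> L2 \<sigma>" using q assms by (intro pval_L2) simp
    show ?thesis
      using L2_integrable[OF perp_L2[OF assms(1)] qL] L2_integrable[OF perp_L2[OF assms(2)] qL]
        assms q by (simp add: distrib_right perp_def)
  qed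
  then show ?thesis using assms L2_add by (simp add: perp_def)
qed

lemma perp_scale: "perp k f \<Longrightarrow> perp k (\<lambda>t. c * f t)"
  by (simp add: perp_def L2_scale mult.assoc)

lemma perp_diff:
  assumes "perp k f" "perp k g" "k \<le> Suc p"
  shows "perp k (\<lambda>t. f t - g t)"
  using perp_add[OF assms(1) perp_scale[OF assms(2), of "-1"] assms(3)] by simp

lemma perp_cong_AE:
  assumes "perp k f" "g \<in> L2 \<sigma>" "AE t in \<sigma>. g t = f t" "k \<le> Suc p"
  shows "perp k g"
proof -
  have "(\<integral>t. g t * pval q t \<partial>\<sigma>) = 0" if q: "degree q < k" for q
  proof -
    have qL: "pval q \<in> L2 \<sigma>" using q assms by (intro pval_L2) simp
    show ?thesis
      using L2_integral_cong[OF assms(2) perp_L2[OF assms(1)] qL assms(3)] assms(1) q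
      by (simp add: perp_def)
  qed
  then show ?thesis using assms by (simp add: perp_def)
qed

lemma perp_ip_cnj: "perp k f \<Longrightarrow> i < k \<Longrightarrow> i \<le> p \<Longrightarrow> ip \<sigma> (pval (E i)) f = 0"
  using ip_cnj[of "pval (E i)" f] by (simp add: ip_def perp_def degree_E)

section \<open>Cauchy transforms of the orthonormal polynomials\<close>

definition psi :: "nat \<Rightarrow> complex \<Rightarrow> complex" where
  "psi k z = (\<integral>t. pval (E k) t * kern z t \<partial>\<sigma>)"

text \<open>Write q(t) = q(z) + (t - z) h(t). The second part contributes (e_k, h), which sees only
  the coefficient of h in degree k, that is, the coefficient of q in degree k + 1. This extra term
  is the source of the constant in \<open>psi_wronskian\<close>.\<close>

lemma integral_E_pval_kern:
  assumes k: "k \<le> p" and deg: "degree q \<le> p" "degree q \<le> Suc k" and z: "z \<notin> \<real>"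
  shows "(\<integral>t. pval (E k) t * pval q t * kern z t \<partial>\<sigma>)
    = poly q z * psi k z + coeff q (Suc k) / of_real (lc k)"
proof -
  define h where "h = synthetic_div q z"
  have h: "degree h \<le> k" "degree h \<le> p" "coeff h k = coeff q (Suc k)"
    using deg coeff_synthetic_div[OF deg(2)] by (auto simp: h_def degree_synthetic_div)
  have "(\<lambda>t. 1) \<in> L2 \<sigma>" by (simp add: L2_def)
  then have kL: "kern z \<in> L2 \<sigma>" using L2_kern[OF z, of "\<lambda>t. 1"] by simp
  have "(\<integral>t. pval (E k) t * pval q t * kern z t \<partial>\<sigma>)
      = (\<integral>t. poly q z * (pval (E k) t * kern z t) + pval (E k) t * pval h t \<partial>\<sigma>)"
    by (rule Bochner_Integration.integral_cong)
      (simp_all add: h_def pval_synthetic_div_kern[OF z] algebra_simps)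
  also have "\<dots> = poly q z * psi k z + coeff h k / of_real (lc k)"
    using L2_integrable[OF E_L2[OF k] kL] L2_integrable[OF E_L2[OF k] pval_L2[OF h(2)]]
      integral_E_pval[OF k h(1)]
    by (simp add: psi_def)
  finally show ?thesis using h by simp
qed

lemma integral_E_pval_kern':
  assumes k: "k \<le> p" and deg: "degree q \<le> k" and z: "z \<notin> \<real>"
  shows "(\<integral>t. pval (E k) t * pval q t * kern z t \<partial>\<sigma>) = poly q z * psi k z"
  using integral_E_pval_kern[OF k _ _ z, of q] assms by (simp add: coeff_eq_0)

text \<open>The product of the two values is the integral of e_k^2 / (t - z), whose imaginary part
  is a positive multiple of Im z.\<close>

lemma E_psi_nonzero:
  assumes k: "k \<le> p" and z: "z \<notin> \<real>"
  shows "poly (E k) z \<noteq> 0" "psi k z \<noteq> 0"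
proof -
  have "ip \<sigma> (pval (E k)) (pval (E k)) \<noteq> 0"
    using integral_E_E[of k k] k by (simp add: ip_def)
  then have "(\<integral>t. pval (E k) t * pval (E k) t * kern z t \<partial>\<sigma>) \<noteq> 0"
    using kern_form_nonzero[OF E_L2[OF k] z] by auto
  then show "poly (E k) z \<noteq> 0" "psi k z \<noteq> 0"
    using integral_E_pval_kern'[OF k _ z, of "E k"] k by (auto simp: degree_E)
qed

text \<open>Both sides compute \<open>\<integral> e\<^sub>p e\<^bsub>p-1\<^esub> / (t - z) d\<sigma>\<close>, expanding one or the other factor about \<open>z\<close>.\<close>
lemma psi_wronskian:
  assumes z: "z \<notin> \<real>"
  shows "poly (E (p - 1)) z * psi p z = poly (E p) z * psi (p - 1) z + 1 / of_real \<beta>"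
proof -
  have "poly (E (p - 1)) z * psi p z = (\<integral>t. pval (E p) t * pval (E (p - 1)) t * kern z t \<partial>\<sigma>)"
    using integral_E_pval_kern'[OF _ _ z, of p "E (p - 1)"] by (simp add: degree_E)
  also have "\<dots> = (\<integral>t. pval (E (p - 1)) t * pval (E p) t * kern z t \<partial>\<sigma>)"
    by (simp add: mult_ac)
  also have "\<dots> = poly (E p) z * psi (p - 1) z + coeff (E p) (Suc (p - 1)) / of_real (lc (p - 1))"
    by (rule integral_E_pval_kern[OF _ _ _ z]) (simp_all add: degree_E)
  finally show ?thesis
    using p_pos by (simp add: coeff_E \<beta>_def)
qed

lemma psi_cnj: "psi k (cnj z) = cnj (psi k z)"
  by (simp add: psi_def kern_cnj flip: Bochner_Integration.integral_cnj)

lemma pCons_E_L2: "pval (pCons 0 (E (p - 1))) \<in> L2 \<sigma>"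
  by (rule pval_L2) (use p_pos in \<open>auto simp: degree_E intro: order.trans[OF degree_pCons_le]\<close>)

lemma ip_app_mult_op_E:
  "ip \<sigma> (app (mult_op \<sigma>) (poly_fun (e (p - 1)))) (poly_fun (e p)) = of_real \<beta>"
proof -
  define x where "x = pval (E (p - 1))"
  have "(x, pval (pCons 0 (E (p - 1)))) \<in> mult_op \<sigma>"
    using pCons_E_L2 E_L2[of "p - 1"] by (simp add: mult_op_def x_def)
  from app_graph[OF this] have g: "app (mult_op \<sigma>) x \<in> L2 \<sigma>"
    and ae: "AE t in \<sigma>. app (mult_op \<sigma>) x t = pval (pCons 0 (E (p - 1))) t"
    by (auto simp: mult_op_def x_def)
  have "ip \<sigma> (app (mult_op \<sigma>) x) (pval (E p)) = ip \<sigma> (pval (pCons 0 (E (p - 1)))) (pval (E p))"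
    by (rule ip_cong_AE[OF g pCons_E_L2 E_L2 ae]) simp
  also have "\<dots> = (\<integral>t. pval (E p) t * pval (pCons 0 (E (p - 1))) t \<partial>\<sigma>)"
    by (simp add: ip_def mult.commute)
  also have "\<dots> = coeff (pCons 0 (E (p - 1))) p / of_real (lc p)"
    by (rule integral_E_pval) (use p_pos in \<open>auto simp: degree_E intro: order.trans[OF degree_pCons_le]\<close>)
  also have "coeff (pCons 0 (E (p - 1))) p = coeff (E (p - 1)) (p - 1)"
    using p_pos by (simp add: coeff_pCons split: nat.split)
  also have "\<dots> / of_real (lc p) = of_real \<beta>"
    by (simp add: coeff_E \<beta>_def)
  finally show ?thesis by (simp add: x_def poly_fun_e)
qed

text \<open>Here \<open>(A\<^sub>0 - z)\<^sup>-\<^sup>1 g = (g - g(z) / e\<^sub>p(z) \<cdot> e\<^sub>p) / (t - z)\<close>, a polynomial of degree below \<open>p\<close>.\<close>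
lemma ip_app_resolvent_span:
  assumes z: "z \<notin> \<real>" and g: "degree g < p" and h: "degree h < p" and hr: "\<And>t. cnj (pval h t) = pval h t"
  shows "ip \<sigma> (app (resolvent (compression \<sigma> (mult_op \<sigma>) (poly_span \<sigma> p)) z) (pval g)) (pval h)
    = (\<integral>t. pval g t * pval h t * kern z t \<partial>\<sigma>) - poly g z / poly (E p) z * poly h z * psi p z"
proof -
  define c where "c = poly g z / poly (E p) z"
  define G where "G = g - Polynomial.smult c (E p)"
  define R where "R = synthetic_div G z"
  have degG: "degree G \<le> p"
    unfolding G_def by (rule degree_diff_le) (use g in \<open>simp_all add: degree_E\<close>)
  then have degR: "degree R < p" using p_pos by (simp add: R_def degree_synthetic_div)
  have Gz: "poly G z = 0" using E_psi_nonzero(1)[of p z] z by (simp add: G_def c_def)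
  have G: "pval G t = pval g t - c * pval (E p) t" for t by (simp add: G_def)
  have "(of_real t - z) * pval R t = pval g t - c * pval (E p) t" for t
    unfolding R_def pval_synthetic_div G Gz by simp
  then have tR: "of_real t * pval R t = pval g t + z * pval R t - c * pval (E p) t" for t
    by (simp add: algebra_simps)
  have R: "pval R t = (pval g t - c * pval (E p) t) * kern z t" for t
    unfolding R_def pval_synthetic_div_kern[OF z] G Gz by simp
  have RL: "pval R \<in> L2 \<sigma>" using degR by (intro pval_L2) simp
  \<comment> \<open>\<open>H\<close> represents \<open>A\<^sub>0\<close> applied to
    \<open>R\<close>: it differs from t R by a multiple of e_p, which is orthogonal to all
    polynomials of degree below p.\<close>
  define H where "H = g + Polynomial.smult z R"
  have degH: "degree H < p"
    unfolding H_def by (rule degree_add_less) (use g degR in auto)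
  have "pval (pCons 0 R) \<in> L2 \<sigma>"
    by (rule pval_L2) (use degR in \<open>auto intro: order.trans[OF degree_pCons_le]\<close>)
  then have "(pval R, pval (pCons 0 R)) \<in> mult_op \<sigma>"
    using RL by (simp add: mult_op_def)
  moreover have "(pval (pCons 0 R), pval H) \<in> proj \<sigma> (poly_span \<sigma> p)"
  proof -
    have "(\<lambda>t. pval (pCons 0 R) t - pval H t) = (\<lambda>t. - c * pval (E p) t)"
      by (auto simp: H_def tR)
    then have "(\<lambda>t. pval (pCons 0 R) t - pval H t) \<in> ortho \<sigma> (poly_span \<sigma> p)"
      unfolding ortho_span_iff using perp_scale[OF perp_E[of p], of "- c"] by simp
    then show ?thesis
      using \<open>pval (pCons 0 R) \<in> L2 \<sigma>\<close> pval_in_span[OF degH] by (simp add: proj_def)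
  qed
  ultimately have "(pval R, pval H) \<in> mult_op \<sigma> O proj \<sigma> (poly_span \<sigma> p)"
    by (rule relcompI)
  then have "(pval R, pval H) \<in> compression \<sigma> (mult_op \<sigma>) (poly_span \<sigma> p)"
    using pval_in_span[OF degR] by (simp add: compression_def)
  then have res: "(pval g, pval R) \<in> resolvent (compression \<sigma> (mult_op \<sigma>) (poly_span \<sigma> p)) z"
    by (rule resolventI) (simp add: H_def)
  have "pval h \<in> L2 \<sigma>" using h by (intro pval_L2) simp
  then have "ip \<sigma> (app (resolvent (compression \<sigma> (mult_op \<sigma>) (poly_span \<sigma> p)) z) (pval g)) (pval h)
      = ip \<sigma> (pval R) (pval h)"
    by (intro ip_app_resolvent_compression[OF span_subset_L2 _ z res] span_diff)
  also have "\<dots> = (\<integral>t. pval g t * pval h t * kern z t - c * (pval (E p) t * pval h t * kern z t) \<partial>\<sigma>)"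
    unfolding ip_def hr R by (simp add: algebra_simps)
  also have "\<dots> = (\<integral>t. pval g t * pval h t * kern z t \<partial>\<sigma>) - c * (poly h z * psi p z)"
  proof -
    have hL: "(\<lambda>t. pval h t * kern z t) \<in> L2 \<sigma>" using h by (intro L2_kern z pval_L2) simp
    have "pval g \<in> L2 \<sigma>" using g by (intro pval_L2) simp
    from L2_integrable[OF this hL] L2_integrable[OF E_p_L2 hL]
    have "complex_integrable \<sigma> (\<lambda>t. pval g t * pval h t * kern z t)"
      "complex_integrable \<sigma> (\<lambda>t. pval (E p) t * pval h t * kern z t)" by (simp_all add: mult.assoc)
    then show ?thesis using integral_E_pval_kern'[of p h z] h z by simp
  qed
  finally show ?thesis by (simp add: c_def)
qed

end

section \<open>The compression to the orthogonal complement\<close>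

context finite_borel_measure
begin

text \<open>Only the top power has to be tested, since lower powers inherit square integrability by
  \<open>L2_pval_degree_mono\<close>. Both domain conditions of the theorem are thus reduced to
  membership of a monomial in L2.\<close>

lemma one_in_Domain_mult_op_power:
  "(\<lambda>t. 1) \<in> Domain (mult_op \<sigma> ^^ m) \<longleftrightarrow> pval (monom 1 m) \<in> L2 \<sigma>"
proof
  have "f \<in> L2 \<sigma> \<and> (AE t in \<sigma>. f t = of_real t ^ m)" if "((\<lambda>t. 1), f) \<in> mult_op \<sigma> ^^ m" for f
    using that
  proof (induction m arbitrary: f)
    case 0
    then show ?case by (auto simp: L2_def)
  next
    case (Suc m)
    then obtain g where g: "((\<lambda>t. 1), g) \<in> mult_op \<sigma> ^^ m" "(g, f) \<in> mult_op \<sigma>" by auto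
    from Suc.IH[OF g(1)] have ae: "AE t in \<sigma>. g t = of_real t ^ m" by blast
    have f: "f \<in> L2 \<sigma>" "AE t in \<sigma>. f t = of_real t * g t"
      using g(2) by (auto simp: mult_op_def)
    from ae f(2) have "AE t in \<sigma>. f t = of_real t ^ Suc m"
      by eventually_elim simp
    with f show ?case by blast
  qed
  moreover assume "(\<lambda>t. 1) \<in> Domain (mult_op \<sigma> ^^ m)"
  ultimately obtain f where f: "f \<in> L2 \<sigma>" and ae: "AE t in \<sigma>. f t = of_real t ^ m" by blast
  have "AE t in \<sigma>. pval (monom 1 m) t = f t" using ae by eventually_elim simp
  from L2_cong_AE[OF f pval_measurable this] show "pval (monom 1 m) \<in> L2 \<sigma>" .
next
  have "((\<lambda>t. 1), pval (monom 1 m)) \<in> mult_op \<sigma> ^^ m" if "pval (monom 1 m) \<in> L2 \<sigma>"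
    using that
  proof (induction m)
    case 0
    then show ?case by (simp add: monom_0 fun_eq_iff pval_def)
  next
    case (Suc m)
    have L2: "pval (monom 1 m) \<in> L2 \<sigma>"
      by (rule L2_pval_degree_mono[OF Suc.prems]) (simp_all add: degree_monom_eq monom_eq_0_iff)
    have "AE t in \<sigma>. pval (monom 1 (Suc m)) t = of_real t * pval (monom 1 m) t" by simp
    with L2 Suc.prems have "(pval (monom 1 m), pval (monom 1 (Suc m))) \<in> mult_op \<sigma>"
      unfolding mult_op_def by blast
    with Suc.IH[OF L2] show ?case by (rule relpow_Suc_I)
  qed
  then show "pval (monom 1 m) \<in> L2 \<sigma> \<Longrightarrow> (\<lambda>t. 1) \<in> Domain (mult_op \<sigma> ^^ m)" by blast
qed

section \<open>Truncation to bounded intervals\<close>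

lemma L2_truncate:
  assumes f: "f \<in> L2 \<sigma>" and N: "N \<ge> 0"
  shows "(\<lambda>t. indicator {- N..N} t *\<^sub>R f t) \<in> L2 \<sigma>"
    and "(\<lambda>t. of_real t * (indicator {- N..N} t *\<^sub>R f t)) \<in> L2 \<sigma>"
proof -
  have [measurable]: "f \<in> borel_measurable borel" using f by (rule L2_measurable)
  show "(\<lambda>t. indicator {- N..N} t *\<^sub>R f t) \<in> L2 \<sigma>"
    by (rule L2_AE[OF f, of _ 1]) (auto simp: indicator_def)
  show "(\<lambda>t. of_real t * (indicator {- N..N} t *\<^sub>R f t)) \<in> L2 \<sigma>"
  proof (rule L2_AE[OF f, of _ N])
    show "AE t in \<sigma>. cmod (of_real t * (indicator {- N..N} t *\<^sub>R f t)) \<le> N * cmod (f t)"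
      by (intro AE_I2) (use N in \<open>auto simp: indicator_def norm_mult intro!: mult_right_mono\<close>)
  qed measurable
qed

lemma L2_truncate_tendsto:
  assumes f: "f \<in> L2 \<sigma>"
  shows "(\<lambda>N. \<integral>t. (cmod (f t - indicator {- real N..real N} t *\<^sub>R f t))\<^sup>2 \<partial>\<sigma>) \<longlonglongrightarrow> 0"
proof -
  have [measurable]: "f \<in> borel_measurable borel" using f by (rule L2_measurable)
  have "(\<lambda>N. \<integral>t. (cmod (f t - indicator {- real N..real N} t *\<^sub>R f t))\<^sup>2 \<partial>\<sigma>)
      \<longlonglongrightarrow> (\<integral>t. 0 \<partial>\<sigma>)"
  proof (rule integral_dominated_convergence[where w = "\<lambda>t. (cmod (f t))\<^sup>2"])
    show "integrable \<sigma> (\<lambda>t. (cmod (f t))\<^sup>2)" using f by (simp add: L2_def)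
    show "AE t in \<sigma>. (\<lambda>N. (cmod (f t - indicator {- real N..real N} t *\<^sub>R f t))\<^sup>2) \<longlonglongrightarrow> 0"
    proof (rule AE_I2)
      fix t :: real
      have "\<forall>\<^sub>F N in sequentially. (cmod (f t - indicator {- real N..real N} t *\<^sub>R f t))\<^sup>2 = 0"
        using eventually_ge_at_top[of "nat \<lceil>\<bar>t\<bar>\<rceil>"]
      proof eventually_elim
        case (elim N)
        then have "\<bar>t\<bar> \<le> real N" by linarith
        then show ?case by (simp add: indicator_def abs_le_iff)
      qed
      then show "(\<lambda>N. (cmod (f t - indicator {- real N..real N} t *\<^sub>R f t))\<^sup>2) \<longlonglongrightarrow> 0"
        by (rule tendsto_eventually)
    qed
    show "AE t in \<sigma>. norm ((cmod (f t - indicator {- real N..real N} t *\<^sub>R f t))\<^sup>2) \<le> (cmod (f t))\<^sup>2"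
      for N by (rule AE_I2) (simp add: indicator_def)
  qed measurable
  then show ?thesis by simp
qed

end

context orthonormal_polys
begin

section \<open>The action of the compression to the complement\<close>

definition up :: "real \<Rightarrow> complex" where
  "up t = of_real \<beta> * pval (E p) t"

text \<open>The inner product (f, u_p); no conjugation appears because u_p is real.\<close>

definition up_coeff :: "(real \<Rightarrow> complex) \<Rightarrow> complex" where
  "up_coeff f = (\<integral>t. f t * up t \<partial>\<sigma>)"

abbreviation D_op :: "(real \<Rightarrow> complex) rel" where
  "D_op \<equiv> compression \<sigma> (mult_op \<sigma>) (ortho \<sigma> (poly_span \<sigma> p))"

lemma up_L2: "up \<in> L2 \<sigma>"
  unfolding up_def using L2_scale[OF E_p_L2] by blast

lemma perp_up: "perp p up"
  unfolding up_def[abs_def] by (intro perp_scale perp_E) simp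

lemma up_coeff_eq: "up_coeff f = of_real \<beta> * (\<integral>t. f t * pval (E p) t \<partial>\<sigma>)"
  unfolding up_coeff_def up_def mult.left_commute[of _ "complex_of_real \<beta>"] by simp

text \<open>For f orthogonal to the polynomials of degree below p, the component of t f among them
  lies along e_(p-1). Indeed t q has degree at most p, so f sees only its coefficient in degree p;
  this is the coefficient of q in degree p - 1, which e_(p-1) sees as well. The two normalizations
  differ by the factor \<beta>.\<close>

lemma perp_integral_shift:
  assumes f: "perp p f" and q: "degree q < p"
  shows "(\<integral>t. f t * pval (pCons 0 q) t \<partial>\<sigma>) = up_coeff f * (\<integral>t. pval (E (p - 1)) t * pval q t \<partial>\<sigma>)"
proof -
  have deg: "degree (pCons 0 q) \<le> p" using q by (auto intro: order.trans[OF degree_pCons_le])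
  have "coeff (pCons 0 q) p = coeff q (p - 1)"
    using p_pos by (simp add: coeff_pCons split: nat.split)
  then have "(\<integral>t. f t * pval (pCons 0 q) t \<partial>\<sigma>)
      = coeff q (p - 1) / of_real (lc p) * (\<integral>t. f t * pval (E p) t \<partial>\<sigma>)"
    using perp_integral[OF f _ deg] by simp
  moreover have "(\<integral>t. pval (E (p - 1)) t * pval q t \<partial>\<sigma>) = coeff q (p - 1) / of_real (lc (p - 1))"
    using q by (intro integral_E_pval) auto
  ultimately show ?thesis
    using lc_pos[of "p - 1"] lc_pos[of p] by (simp add: up_coeff_eq \<beta>_def field_simps)
qed

lemma shift_L2: "degree q < p \<Longrightarrow> pval (pCons 0 q) \<in> L2 \<sigma>"
  by (rule pval_L2) (auto intro: order.trans[OF degree_pCons_le])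

lemma perp_mult:
  assumes f: "perp p f" and tf: "(\<lambda>t. of_real t * f t) \<in> L2 \<sigma>"
  shows "perp p (\<lambda>t. of_real t * f t - up_coeff f * pval (E (p - 1)) t)"
proof -
  have EL: "pval (E (p - 1)) \<in> L2 \<sigma>" by (simp add: E_L2)
  have "(\<integral>t. (of_real t * f t - up_coeff f * pval (E (p - 1)) t) * pval q t \<partial>\<sigma>) = 0" if q: "degree q < p" for q
  proof -
    have qL: "pval q \<in> L2 \<sigma>" using q by (intro pval_L2) simp
    have "(\<integral>t. (of_real t * f t - up_coeff f * pval (E (p - 1)) t) * pval q t \<partial>\<sigma>)
        = (\<integral>t. f t * pval (pCons 0 q) t - up_coeff f * (pval (E (p - 1)) t * pval q t) \<partial>\<sigma>)"
      by (rule Bochner_Integration.integral_cong) (simp_all add: algebra_simps)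
    also have "\<dots> = 0"
      using L2_integrable[OF perp_L2[OF f] shift_L2[OF q]] L2_integrable[OF EL qL]
        perp_integral_shift[OF f q] by (simp del: pval_simps)
    finally show ?thesis .
  qed
  then show ?thesis
    using L2_diff[OF tf L2_scale[OF EL, of "up_coeff f"]] by (auto simp: perp_def)
qed

text \<open>Replaces the abstract projection by an explicit formula. In the forward direction the
  given image g and the explicit one both lie in the complement and both differ from t f by
  something orthogonal to it, so their difference is orthogonal to itself.\<close>

lemma D_op_iff:
  "(f, g) \<in> D_op \<longleftrightarrow> perp p f \<and> (\<lambda>t. of_real t * f t) \<in> L2 \<sigma> \<and> g \<in> L2 \<sigma>
    \<and> (AE t in \<sigma>. g t = of_real t * f t - up_coeff f * pval (E (p - 1)) t)"
proof -
  define g\<^sub>0 where "g\<^sub>0 = (\<lambda>t. of_real t * f t - up_coeff f * pval (E (p - 1)) t)"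
  have EL: "pval (E (p - 1)) \<in> L2 \<sigma>" by (simp add: E_L2)
  have orth: "ip \<sigma> (\<lambda>t. up_coeff f * pval (E (p - 1)) t) k = 0" if "perp p k" for k
    unfolding ip_scale using perp_ip_cnj[OF that, of "p - 1"] p_pos by simp
  show ?thesis
  proof
    assume "(f, g) \<in> D_op"
    then obtain h where f: "perp p f" and h: "h \<in> L2 \<sigma>" and ae: "AE t in \<sigma>. h t = of_real t * f t"
      and g: "perp p g" and hg: "(\<lambda>t. h t - g t) \<in> L2 \<sigma>"
      and hg_ortho: "\<And>k. perp p k \<Longrightarrow> ip \<sigma> (\<lambda>t. h t - g t) k = 0"
      by (auto simp: compression_def mult_op_def proj_def ortho_span_iff ortho_def[of \<sigma> "ortho _ _"])
    have fL [measurable]: "f \<in> borel_measurable borel" using f perp_L2 L2_measurable by blast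
    have ae': "AE t in \<sigma>. of_real t * f t = h t" using ae by eventually_elim simp
    have tf: "(\<lambda>t. of_real t * f t) \<in> L2 \<sigma>" by (rule L2_cong_AE[OF h _ ae']) measurable
    have g0: "perp p g\<^sub>0" unfolding g\<^sub>0_def by (rule perp_mult[OF f tf])
    define k where "k = (\<lambda>t. g\<^sub>0 t - g t)"
    have k: "perp p k" unfolding k_def by (intro perp_diff g0 g) simp
    have "ip \<sigma> k k = ip \<sigma> (\<lambda>t. (h t - g t) - up_coeff f * pval (E (p - 1)) t) k"
    proof (rule ip_cong_AE)
      show "AE t in \<sigma>. k t = (h t - g t) - up_coeff f * pval (E (p - 1)) t"
        using ae by eventually_elim (simp add: k_def g\<^sub>0_def)
    qed (intro perp_L2[OF k] L2_diff[OF hg] L2_scale EL)+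
    also have "\<dots> = 0"
      unfolding ip_diff[OF hg L2_scale[OF EL] perp_L2[OF k]] hg_ortho[OF k] orth[OF k] by simp
    finally have "AE t in \<sigma>. k t = 0" by (rule L2_orthogonal_self[OF perp_L2[OF k]])
    then have "AE t in \<sigma>. g t = g\<^sub>0 t" by eventually_elim (simp add: k_def)
    then show "perp p f \<and> (\<lambda>t. of_real t * f t) \<in> L2 \<sigma> \<and> g \<in> L2 \<sigma>
        \<and> (AE t in \<sigma>. g t = of_real t * f t - up_coeff f * pval (E (p - 1)) t)"
      using f tf perp_L2[OF g] by (simp add: g\<^sub>0_def)
  next
    assume "perp p f \<and> (\<lambda>t. of_real t * f t) \<in> L2 \<sigma> \<and> g \<in> L2 \<sigma>
      \<and> (AE t in \<sigma>. g t = of_real t * f t - up_coeff f * pval (E (p - 1)) t)"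
    then have f: "perp p f" and tf: "(\<lambda>t. of_real t * f t) \<in> L2 \<sigma>" and gL: "g \<in> L2 \<sigma>"
      and ae: "AE t in \<sigma>. g t = of_real t * f t - up_coeff f * pval (E (p - 1)) t" by auto
    have g: "perp p g" by (rule perp_cong_AE[OF perp_mult[OF f tf] gL ae]) simp
    have "ip \<sigma> (\<lambda>t. of_real t * f t - g t) k = 0" if k: "perp p k" for k
    proof -
      have "ip \<sigma> (\<lambda>t. of_real t * f t - g t) k = ip \<sigma> (\<lambda>t. up_coeff f * pval (E (p - 1)) t) k"
      proof (rule ip_cong_AE)
        show "AE t in \<sigma>. of_real t * f t - g t = up_coeff f * pval (E (p - 1)) t"
          using ae by eventually_elim simp
      qed (intro perp_L2[OF k] L2_diff tf gL L2_scale EL)+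
      then show ?thesis using orth[OF k] by simp
    qed
    then have "((\<lambda>t. of_real t * f t), g) \<in> proj \<sigma> (ortho \<sigma> (poly_span \<sigma> p))"
      using tf g L2_diff[OF tf gL] unfolding proj_def
      by (simp add: ortho_span_iff ortho_def[of \<sigma> "ortho _ _"])
    moreover have "(f, \<lambda>t. of_real t * f t) \<in> mult_op \<sigma>"
      using perp_L2[OF f] tf by (simp add: mult_op_def)
    ultimately have "(f, g) \<in> mult_op \<sigma> O proj \<sigma> (ortho \<sigma> (poly_span \<sigma> p))" by blast
    then show "(f, g) \<in> D_op" using f by (simp add: compression_def ortho_span_iff)
  qed
qed

lemma D_op_I:
  assumes "perp p f" "(\<lambda>t. of_real t * f t) \<in> L2 \<sigma>"
  shows "(f, \<lambda>t. of_real t * f t - up_coeff f * pval (E (p - 1)) t) \<in> D_op"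
  unfolding D_op_iff using assms perp_L2[OF perp_mult[OF assms]] by simp

section \<open>Self-adjointness of the compression\<close>

lemma ip_D_op:
  assumes "(f, f') \<in> D_op" "perp p g"
  shows "ip \<sigma> f' g = ip \<sigma> (\<lambda>t. of_real t * f t) g"
proof -
  from assms(1) have f: "perp p f" and tf: "(\<lambda>t. of_real t * f t) \<in> L2 \<sigma>" and f': "f' \<in> L2 \<sigma>"
    and ae: "AE t in \<sigma>. f' t = of_real t * f t - up_coeff f * pval (E (p - 1)) t"
    by (auto simp: D_op_iff)
  have EL: "pval (E (p - 1)) \<in> L2 \<sigma>" by (simp add: E_L2)
  have "ip \<sigma> f' g = ip \<sigma> (\<lambda>t. of_real t * f t - up_coeff f * pval (E (p - 1)) t) g"
    by (rule ip_cong_AE[OF f' _ perp_L2[OF assms(2)] ae]) (intro L2_diff tf L2_scale EL)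
  also have "\<dots> = ip \<sigma> (\<lambda>t. of_real t * f t) g - up_coeff f * ip \<sigma> (pval (E (p - 1))) g"
    unfolding ip_diff[OF tf L2_scale[OF EL] perp_L2[OF assms(2)]] ip_scale ..
  also have "ip \<sigma> (pval (E (p - 1))) g = 0"
    using perp_ip_cnj[OF assms(2), of "p - 1"] p_pos by simp
  finally show ?thesis by simp
qed

text \<open>The orthogonal projection onto the polynomials of degree below p as a Fourier sum; the
  \<open>E i\<close> are real on the real line, hence no conjugation.\<close>

definition projpoly :: "(real \<Rightarrow> complex) \<Rightarrow> complex poly" where
  "projpoly x = (\<Sum>i<p. Polynomial.smult (\<integral>t. x t * pval (E i) t \<partial>\<sigma>) (E i))"

lemma degree_projpoly: "degree (projpoly x) < p"
  unfolding projpoly_def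
  by (rule degree_sum_less) (use p_pos in \<open>auto intro: le_less_trans[OF degree_smult_le] simp: degree_E\<close>)

lemma projpoly_L2: "pval (projpoly x) \<in> L2 \<sigma>"
  using degree_projpoly[of x] by (intro pval_L2) simp

lemma perp_projpoly:
  assumes x: "x \<in> L2 \<sigma>"
  shows "perp p (\<lambda>t. x t - pval (projpoly x) t)"
proof (rule perp_basis)
  show "(\<lambda>t. x t - pval (projpoly x) t) \<in> L2 \<sigma>"
    by (intro L2_diff x projpoly_L2)
  fix i assume i: "i < p"
  have int: "integrable \<sigma> (\<lambda>t. pval (E k) t * pval (E i) t)" if "k < p" for k
    using that i by (intro L2_integrable E_L2) auto
  have "(\<integral>t. pval (projpoly x) t * pval (E i) t \<partial>\<sigma>)
      = (\<integral>t. (\<Sum>k<p. (\<integral>t. x t * pval (E k) t \<partial>\<sigma>) * (pval (E k) t * pval (E i) t)) \<partial>\<sigma>)"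
    by (simp add: projpoly_def pval_sum sum_distrib_right mult.assoc)
  also have "\<dots> = (\<Sum>k<p. (\<integral>t. x t * pval (E k) t \<partial>\<sigma>) * (\<integral>t. pval (E k) t * pval (E i) t \<partial>\<sigma>))"
    using int by (subst Bochner_Integration.integral_sum) auto
  also have "\<dots> = (\<Sum>k<p. if k = i then \<integral>t. x t * pval (E k) t \<partial>\<sigma> else 0)"
    using i by (intro sum.cong) (simp_all add: integral_E_E)
  also have "\<dots> = (\<integral>t. x t * pval (E i) t \<partial>\<sigma>)"
    using i by simp
  finally show "(\<integral>t. (x t - pval (projpoly x) t) * pval (E i) t \<partial>\<sigma>) = 0"
    using L2_integrable[OF x E_L2[of i]] L2_integrable[OF projpoly_L2 E_L2[of i]] i
    by (simp add: left_diff_distrib)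
qed simp

lemma perp_ip_span:
  assumes f: "perp p f" and q: "degree q < p"
  shows "ip \<sigma> (pval q) f = 0" "ip \<sigma> f (pval q) = 0"
proof -
  show *: "ip \<sigma> f (pval q) = 0"
    using f pval_in_span[OF q] by (simp add: ortho_def flip: ortho_span_iff)
  show "ip \<sigma> (pval q) f = 0" using ip_cnj[of "pval q" f] * by simp
qed

text \<open>Pythagoras for x and its projection. It guarantees that moving an approximation into the
  complement does not enlarge the error.\<close>

lemma norm_projpoly_le:
  assumes x: "x \<in> L2 \<sigma>"
  shows "(\<integral>t. (cmod (x t - pval (projpoly x) t))\<^sup>2 \<partial>\<sigma>) \<le> (\<integral>t. (cmod (x t))\<^sup>2 \<partial>\<sigma>)"
proof -
  define y where "y = (\<lambda>t. x t - pval (projpoly x) t)"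
  define r where "r = pval (projpoly x)"
  have r: "r \<in> L2 \<sigma>" by (simp add: r_def projpoly_L2)
  have y: "perp p y" unfolding y_def by (rule perp_projpoly[OF x])
  then have yL: "y \<in> L2 \<sigma>" by (rule perp_L2)
  have yr: "ip \<sigma> y r = 0" "ip \<sigma> r y = 0"
    unfolding r_def using perp_ip_span[OF y degree_projpoly] by auto
  have "x = (\<lambda>t. y t + r t)" by (simp add: y_def r_def)
  then have *: "ip \<sigma> x k = ip \<sigma> y k + ip \<sigma> r k" if "k \<in> L2 \<sigma>" for k
    using ip_add[OF yL r that] by simp
  have "ip \<sigma> x x = ip \<sigma> y x + ip \<sigma> r x" by (rule *[OF x])
  also have "\<dots> = cnj (ip \<sigma> x y) + cnj (ip \<sigma> x r)"
    using ip_cnj by metis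
  also have "\<dots> = cnj (ip \<sigma> y y) + cnj (ip \<sigma> r r)"
    by (simp add: *[OF yL] *[OF r] yr)
  finally have "complex_of_real (\<integral>t. (cmod (x t))\<^sup>2 \<partial>\<sigma>)
      = of_real ((\<integral>t. (cmod (y t))\<^sup>2 \<partial>\<sigma>) + (\<integral>t. (cmod (r t))\<^sup>2 \<partial>\<sigma>))"
    by (simp add: ip_def integral_norm_sq)
  then have "(\<integral>t. (cmod (x t))\<^sup>2 \<partial>\<sigma>) = (\<integral>t. (cmod (y t))\<^sup>2 \<partial>\<sigma>) + (\<integral>t. (cmod (r t))\<^sup>2 \<partial>\<sigma>)"
    by (simp only: of_real_eq_iff)
  moreover have "(\<integral>t. (cmod (r t))\<^sup>2 \<partial>\<sigma>) \<ge> 0" by simp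
  ultimately show ?thesis by (simp add: y_def)
qed

text \<open>The projection of dom A to the complement stays in dom A: multiplication by t takes the
  removed polynomial to one of degree at most p, still square integrable. This supplies the test
  vectors for density and maximality.\<close>

lemma projpoly_in_Domain:
  assumes x: "x \<in> L2 \<sigma>" and tx: "(\<lambda>t. of_real t * x t) \<in> L2 \<sigma>"
  shows "((\<lambda>t. x t - pval (projpoly x) t),
    (\<lambda>t. of_real t * (x t - pval (projpoly x) t)
      - up_coeff (\<lambda>t. x t - pval (projpoly x) t) * pval (E (p - 1)) t)) \<in> D_op"
proof (rule D_op_I[OF perp_projpoly[OF x]])
  have "(\<lambda>t. of_real t * x t - pval (pCons 0 (projpoly x)) t) \<in> L2 \<sigma>"
    by (intro L2_diff tx shift_L2 degree_projpoly)
  then show "(\<lambda>t. of_real t * (x t - pval (projpoly x) t)) \<in> L2 \<sigma>"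
    by (simp add: algebra_simps)
qed

text \<open>Truncations of f lie in dom A and approximate f; projecting them to the complement gives
  elements of dom D without loss in the estimate.\<close>

lemma D_op_dense:
  assumes f: "perp p f" and eps: "\<epsilon> > 0"
  shows "\<exists>g\<in>Domain D_op. L2_norm \<sigma> (\<lambda>t. f t - g t) < \<epsilon>"
proof -
  have fL: "f \<in> L2 \<sigma>" using f by (rule perp_L2)
  have "\<forall>\<^sub>F N in sequentially.
      (\<integral>t. (cmod (f t - indicator {- real N..real N} t *\<^sub>R f t))\<^sup>2 \<partial>\<sigma>) < \<epsilon>\<^sup>2"
    by (rule order_tendstoD[OF L2_truncate_tendsto[OF fL]]) (use eps in simp)
  then obtain N :: nat
    where N: "(\<integral>t. (cmod (f t - indicator {- real N..real N} t *\<^sub>R f t))\<^sup>2 \<partial>\<sigma>) < \<epsilon>\<^sup>2"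
    using eventually_happens trivial_limit_sequentially by blast
  define x where "x = (\<lambda>t. indicator {- real N..real N} t *\<^sub>R f t)"
  define y where "y = (\<lambda>t. f t - x t)"
  have x: "x \<in> L2 \<sigma>" "(\<lambda>t. of_real t * x t) \<in> L2 \<sigma>"
    unfolding x_def by (rule L2_truncate[OF fL]; simp)+
  have y: "y \<in> L2 \<sigma>" unfolding y_def by (rule L2_diff[OF fL x(1)])
  \<comment> \<open>As f is already in the complement, projecting the error f - x gives f minus the
    projected x.\<close>
  have "projpoly f = 0"
    using f by (simp add: projpoly_def perp_def degree_E)
  moreover have "projpoly y = projpoly f - projpoly x"
    unfolding projpoly_def sum_subtractf[symmetric]
    using L2_integrable[OF fL E_L2] L2_integrable[OF x(1) E_L2]
    by (intro sum.cong) (simp_all add: y_def left_diff_distrib smult_diff_left)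
  ultimately have eq: "y t - pval (projpoly y) t = f t - (x t - pval (projpoly x) t)" for t
    using pval_simps(5)[of 0 "projpoly x" t] by (simp add: y_def)
  have "(\<integral>t. (cmod (y t))\<^sup>2 \<partial>\<sigma>) < \<epsilon>\<^sup>2" using N by (simp only: y_def x_def)
  then have "(\<integral>t. (cmod (f t - (x t - pval (projpoly x) t)))\<^sup>2 \<partial>\<sigma>) < \<epsilon>\<^sup>2"
    by (rule le_less_trans[OF norm_projpoly_le[OF y, unfolded eq]])
  then have "L2_norm \<sigma> (\<lambda>t. f t - (x t - pval (projpoly x) t)) < \<epsilon>"
    unfolding L2_norm_def using eps real_sqrt_less_mono by fastforce
  then show ?thesis using projpoly_in_Domain[OF x] by (auto simp: Domain_iff)
qed

lemma D_op_symmetric: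
  assumes f: "(f, f') \<in> D_op" and g: "(g, g') \<in> D_op"
  shows "ip \<sigma> f' g = ip \<sigma> f g'"
proof -
  have fp: "perp p f" and gp: "perp p g" using f g by (auto simp: D_op_iff)
  have "ip \<sigma> f' g = ip \<sigma> (\<lambda>t. of_real t * f t) g" by (rule ip_D_op[OF f gp])
  also have "\<dots> = ip \<sigma> f (\<lambda>t. of_real t * g t)" by (simp add: ip_def mult_ac)
  also have "\<dots> = cnj (ip \<sigma> (\<lambda>t. of_real t * g t) f)" by (rule ip_cnj)
  also have "\<dots> = cnj (ip \<sigma> g' f)" using ip_D_op[OF g fp] by simp
  also have "\<dots> = ip \<sigma> f g'" by (rule ip_cnj[symmetric])
  finally show ?thesis .
qed

text \<open>Testing against the projection of \<open>1\<^bsub>[-N,N]\<^esub> (t g - g' - c e\<^bsub>p-1\<^esub>)\<close> shows that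
  this truncated function has norm zero.\<close>
lemma D_op_maximal:
  assumes g: "perp p g" and g': "perp p g'"
    and adj: "\<And>f f'. (f, f') \<in> D_op \<Longrightarrow> ip \<sigma> f' g = ip \<sigma> f g'"
  shows "(g, g') \<in> D_op"
proof -
  define w where "w = (\<lambda>t. g' t + up_coeff g * pval (E (p - 1)) t)"
  define v where "v = (\<lambda>t. of_real t * g t - w t)"
  have gL: "g \<in> L2 \<sigma>" and g'L: "g' \<in> L2 \<sigma>" and EL: "pval (E (p - 1)) \<in> L2 \<sigma>"
    using g g' by (auto simp: perp_L2 E_L2)
  have wL: "w \<in> L2 \<sigma>" unfolding w_def by (intro L2_add g'L L2_scale EL)
  have [measurable]: "g \<in> borel_measurable borel" "w \<in> borel_measurable borel"
    using gL wL L2_measurable by auto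
  have "AE t in \<sigma>. indicator {- real N..real N} t *\<^sub>R v t = 0" for N
  proof -
    define h where "h = (\<lambda>t. indicator {- real N..real N} t *\<^sub>R v t)"
    have "h = (\<lambda>t. of_real t * (indicator {- real N..real N} t *\<^sub>R g t)
        - indicator {- real N..real N} t *\<^sub>R w t)"
      by (auto simp: h_def v_def scaleR_conv_of_real algebra_simps)
    then have hL: "h \<in> L2 \<sigma>"
      using L2_diff[OF L2_truncate(2)[OF gL] L2_truncate(1)[OF wL]] by simp
    have h_trunc: "h = (\<lambda>t. indicator {- real N..real N} t *\<^sub>R h t)"
      by (auto simp: h_def indicator_def)
    have thL: "(\<lambda>t. of_real t * h t) \<in> L2 \<sigma>"
      by (subst h_trunc) (rule L2_truncate(2)[OF hL], simp)
    define f where "f = (\<lambda>t. h t - pval (projpoly h) t)"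
    have f: "perp p f" unfolding f_def by (rule perp_projpoly[OF hL])
    note fD = projpoly_in_Domain[OF hL thL, folded f_def]
    have shL: "pval (pCons 0 (projpoly h)) \<in> L2 \<sigma>" by (rule shift_L2[OF degree_projpoly])
    have "ip \<sigma> (\<lambda>t. of_real t * h t) g - ip \<sigma> (pval (pCons 0 (projpoly h))) g
        = ip \<sigma> (\<lambda>t. of_real t * f t) g"
      unfolding ip_diff[OF thL shL gL, symmetric] by (simp add: f_def algebra_simps)
    also have "\<dots> = ip \<sigma> f g'"
      using ip_D_op[OF fD g] adj[OF fD] by simp
    also have "\<dots> = ip \<sigma> h g'"
      using perp_ip_span(1)[OF g' degree_projpoly[of h]]
      unfolding f_def ip_diff[OF hL projpoly_L2 g'L] by simp
    finally have 1: "ip \<sigma> (\<lambda>t. of_real t * h t) g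
      = ip \<sigma> h g' + ip \<sigma> (pval (pCons 0 (projpoly h))) g" by (simp add: algebra_simps)
    \<comment> \<open>The polynomial part of the test function cannot be dropped: t times it may
      have degree p. By \<open>perp_integral_shift\<close> its pairing with g is exactly the
      correction term contained in \<open>w\<close>.\<close>
    have "ip \<sigma> g (pval (pCons 0 (projpoly h)))
        = (\<integral>t. g t * pval (pCons 0 (map_poly cnj (projpoly h))) t \<partial>\<sigma>)"
      by (simp add: ip_def cnj_pval[symmetric])
    also have "\<dots> = up_coeff g * ip \<sigma> (pval (E (p - 1))) (pval (projpoly h))"
      using perp_integral_shift[OF g, of "map_poly cnj (projpoly h)"]
        degree_projpoly[of h] map_poly_degree_leq[of cnj "projpoly h"]
      by (simp add: ip_def cnj_pval del: pval_simps)
    also have "\<dots> = up_coeff g * ip \<sigma> (pval (E (p - 1))) h"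
    proof -
      have "ip \<sigma> h (pval (E (p - 1))) = ip \<sigma> (\<lambda>t. f t + pval (projpoly h) t) (pval (E (p - 1)))"
        by (simp add: f_def)
      also have "\<dots> = ip \<sigma> (pval (projpoly h)) (pval (E (p - 1)))"
        unfolding ip_add[OF perp_L2[OF f] projpoly_L2 EL]
        using perp_ip_span(2)[OF f, of "E (p - 1)"] p_pos by (simp add: degree_E)
      finally have "cnj (ip \<sigma> h (pval (E (p - 1)))) = cnj (ip \<sigma> (pval (projpoly h)) (pval (E (p - 1))))"
        by simp
      then show ?thesis by (simp only: ip_cnj[symmetric])
    qed
    finally have "cnj (ip \<sigma> g (pval (pCons 0 (projpoly h))))
        = cnj (ip \<sigma> (\<lambda>t. up_coeff g * pval (E (p - 1)) t) h)" by (simp add: ip_scale)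
    then have 2: "ip \<sigma> (pval (pCons 0 (projpoly h))) g = ip \<sigma> h (\<lambda>t. up_coeff g * pval (E (p - 1)) t)"
      by (simp only: ip_cnj[symmetric])
    have int: "integrable \<sigma> (\<lambda>t. of_real t * h t * cnj (g t))" "integrable \<sigma> (\<lambda>t. h t * cnj (w t))"
      using L2_integrable[OF thL L2_cnj[OF gL]] L2_integrable[OF hL L2_cnj[OF wL]] by auto
    have int': "integrable \<sigma> (\<lambda>t. h t * cnj (g' t))"
      "integrable \<sigma> (\<lambda>t. h t * cnj (up_coeff g * pval (E (p - 1)) t))"
      using L2_integrable[OF hL L2_cnj[OF g'L]] L2_integrable[OF hL L2_cnj[OF L2_scale[OF EL]]] by auto
    have "ip \<sigma> h w = ip \<sigma> h g' + ip \<sigma> h (\<lambda>t. up_coeff g * pval (E (p - 1)) t)"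
      unfolding ip_def Bochner_Integration.integral_add[OF int', symmetric]
      by (rule Bochner_Integration.integral_cong) (simp_all add: w_def algebra_simps)
    with 1 2 have "ip \<sigma> (\<lambda>t. of_real t * h t) g - ip \<sigma> h w = 0" by simp
    moreover have "ip \<sigma> h h = ip \<sigma> (\<lambda>t. of_real t * h t) g - ip \<sigma> h w"
      unfolding ip_def Bochner_Integration.integral_diff[OF int, symmetric]
      by (rule Bochner_Integration.integral_cong)
        (auto simp: h_def v_def indicator_def algebra_simps)
    ultimately have "ip \<sigma> h h = 0" by simp
    from L2_orthogonal_self[OF hL this] show ?thesis by (simp add: h_def)
  qed
  then have "AE t in \<sigma>. \<forall>N. indicator {- real N..real N} t *\<^sub>R v t = 0"
    unfolding AE_all_countable by blast
  then have v: "AE t in \<sigma>. of_real t * g t = w t"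
  proof eventually_elim
    case (elim t)
    obtain N where "\<bar>t\<bar> \<le> real N" using real_arch_simple by blast
    with elim[rule_format, of N] show ?case by (simp add: v_def abs_le_iff indicator_def)
  qed
  have tg: "(\<lambda>t. of_real t * g t) \<in> L2 \<sigma>" by (rule L2_cong_AE[OF wL _ v]) measurable
  have "AE t in \<sigma>. g' t = of_real t * g t - up_coeff g * pval (E (p - 1)) t"
    using v by eventually_elim (simp add: w_def)
  then show ?thesis using g tg g'L by (simp add: D_op_iff)
qed

lemma D_op_range: "(f, g) \<in> D_op \<Longrightarrow> perp p f \<and> perp p g"
  by (auto simp: compression_def proj_def ortho_span_iff)

lemma D_op_self_adjoint: "self_adjoint_in \<sigma> (ortho \<sigma> (poly_span \<sigma> p)) D_op"
proof -
  have "(g, g') \<in> adjoint_in \<sigma> (ortho \<sigma> (poly_span \<sigma> p)) D_op \<longleftrightarrow> (g, g') \<in> D_op" for g g'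
  proof
    assume "(g, g') \<in> adjoint_in \<sigma> (ortho \<sigma> (poly_span \<sigma> p)) D_op"
    then have "perp p g" "perp p g'" "\<forall>(f, f')\<in>D_op. ip \<sigma> f' g = ip \<sigma> f g'"
      by (simp_all add: adjoint_in_def ortho_span_iff)
    then show "(g, g') \<in> D_op" by (intro D_op_maximal) auto
  next
    assume g: "(g, g') \<in> D_op"
    then show "(g, g') \<in> adjoint_in \<sigma> (ortho \<sigma> (poly_span \<sigma> p)) D_op"
      using D_op_range[OF g] D_op_symmetric[OF _ g] by (auto simp: adjoint_in_def ortho_span_iff)
  qed
  then have "D_op = adjoint_in \<sigma> (ortho \<sigma> (poly_span \<sigma> p)) D_op" by auto
  then show ?thesis
    unfolding self_adjoint_in_def using D_op_dense by (simp add: ortho_span_iff)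
qed

section \<open>The resolvent of the compression and its powers at the vector u_p\<close>

definition D_fun :: "complex \<Rightarrow> complex" where
  "D_fun z = - of_real \<beta> * psi p z / psi (p - 1) z"

text \<open>This is \<open>(D - z)\<^sup>-\<^sup>1 u\<^sub>p\<close>: it must have this form for some constant in place of \<open>D_fun z\<close>, and the
  constant is then determined by orthogonality to \<open>1\<close>.\<close>
definition D_sol :: "complex \<Rightarrow> real \<Rightarrow> complex" where
  "D_sol z t = (up t + D_fun z * pval (E (p - 1)) t) * kern z t"

lemma D_sol_L2: "z \<notin> \<real> \<Longrightarrow> D_sol z \<in> L2 \<sigma>"
  unfolding D_sol_def[abs_def] by (intro L2_kern L2_add up_L2 L2_scale E_L2) simp_all

text \<open>The constant \<open>D_fun z\<close> makes both multiples of q(z) cancel. What is left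
  sees only the coefficient of q in degree p: for degree below p this gives orthogonality, and for q
  = e_p it gives (\<open>D_sol\<close>, u_p).\<close>

lemma integral_D_sol_pval:
  assumes z: "z \<notin> \<real>" and q: "degree q \<le> p"
  shows "(\<integral>t. D_sol z t * pval q t \<partial>\<sigma>) = D_fun z * (coeff q p / of_real (lc (p - 1)))"
proof -
  have qL: "(\<lambda>t. pval q t * kern z t) \<in> L2 \<sigma>" using q by (intro L2_kern z pval_L2)
  have int: "complex_integrable \<sigma> (\<lambda>t. pval (E p) t * pval q t * kern z t)"
    "complex_integrable \<sigma> (\<lambda>t. pval (E (p - 1)) t * pval q t * kern z t)"
    using L2_integrable[OF E_L2 qL] by (simp_all add: mult.assoc)
  have "(\<integral>t. D_sol z t * pval q t \<partial>\<sigma>)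
      = (\<integral>t. of_real \<beta> * (pval (E p) t * pval q t * kern z t)
          + D_fun z * (pval (E (p - 1)) t * pval q t * kern z t) \<partial>\<sigma>)"
    by (rule Bochner_Integration.integral_cong) (simp_all add: D_sol_def up_def algebra_simps)
  also have "\<dots> = of_real \<beta> * (poly q z * psi p z)
      + D_fun z * (poly q z * psi (p - 1) z + coeff q (Suc (p - 1)) / of_real (lc (p - 1)))"
    using int integral_E_pval_kern'[OF _ q z] integral_E_pval_kern[of "p - 1" q z] q z by simp
  also have "\<dots> = D_fun z * (coeff q p / of_real (lc (p - 1)))"
    using E_psi_nonzero(2)[of "p - 1" z] z p_pos by (simp add: D_fun_def field_simps)
  finally show ?thesis .
qed

lemma perp_D_sol:
  assumes z: "z \<notin> \<real>"
  shows "perp p (D_sol z)"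
  unfolding perp_def using integral_D_sol_pval[OF z] D_sol_L2[OF z] by (auto simp: coeff_eq_0)

lemma up_coeff_D_sol:
  assumes z: "z \<notin> \<real>"
  shows "up_coeff (D_sol z) = D_fun z"
  unfolding up_coeff_eq using integral_D_sol_pval[OF z, of "E p"] lc_pos[of p] lc_pos[of "p - 1"]
  by (simp add: degree_E coeff_E \<beta>_def)

lemma mult_D_sol:
  assumes z: "z \<notin> \<real>"
  shows "of_real t * D_sol z t = up t + z * D_sol z t + D_fun z * pval (E (p - 1)) t"
proof -
  have "of_real t * D_sol z t = (up t + D_fun z * pval (E (p - 1)) t) * (of_real t * kern z t)"
    by (simp add: D_sol_def)
  then show ?thesis unfolding kern_mult_t[OF z] by (simp add: D_sol_def algebra_simps)
qed

lemma D_sol_in_D_op: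
  assumes z: "z \<notin> \<real>"
  shows "(D_sol z, \<lambda>t. up t + z * D_sol z t) \<in> D_op"
proof -
  have L: "(\<lambda>t. up t + z * D_sol z t) \<in> L2 \<sigma>" by (intro L2_add up_L2 L2_scale D_sol_L2 z)
  have "(\<lambda>t. of_real t * D_sol z t) \<in> L2 \<sigma>"
    unfolding mult_D_sol[OF z] by (intro L2_add L L2_scale E_L2) simp
  then show ?thesis unfolding D_op_iff
    using L perp_D_sol[OF z] by (simp add: mult_D_sol[OF z] up_coeff_D_sol[OF z])
qed

lemma ip_app_resolvent_D_op:
  assumes z: "z \<notin> \<real>"
  shows "ip \<sigma> (app (resolvent D_op z) up) up = D_fun z"
proof -
  have "(up, D_sol z) \<in> resolvent D_op z" by (rule resolventI[OF D_sol_in_D_op[OF z]]) simp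
  then have "ip \<sigma> (app (resolvent D_op z) up) up = ip \<sigma> (D_sol z) up"
  proof (intro ip_app_resolvent_compression z up_L2)
    show "ortho \<sigma> (poly_span \<sigma> p) \<subseteq> L2 \<sigma>" by (auto simp: ortho_def)
    show "(\<lambda>t. f t - g t) \<in> ortho \<sigma> (poly_span \<sigma> p)"
      if "f \<in> ortho \<sigma> (poly_span \<sigma> p)" "g \<in> ortho \<sigma> (poly_span \<sigma> p)" for f g
      using that perp_diff by (simp add: ortho_span_iff)
  qed
  also have "\<dots> = up_coeff (D_sol z)" by (simp add: ip_def up_coeff_def up_def)
  finally show ?thesis using up_coeff_D_sol[OF z] by simp
qed

text \<open>Pair D s = u_p + z s with the solution s. The left side (D s, s) is real by symmetry,
  and (u_p, s) is the conjugate of \<open>D_fun z\<close>.\<close>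

lemma Im_D_fun:
  assumes z: "z \<notin> \<real>"
  shows "Im (D_fun z) = Im z * (\<integral>t. (cmod (D_sol z t))\<^sup>2 \<partial>\<sigma>)"
proof -
  have sL: "D_sol z \<in> L2 \<sigma>" by (rule D_sol_L2[OF z])
  have L: "(\<lambda>t. up t + z * D_sol z t) \<in> L2 \<sigma>" by (intro L2_add up_L2 L2_scale sL)
  note s = D_sol_in_D_op[OF z]
  have "ip \<sigma> (\<lambda>t. up t + z * D_sol z t) (D_sol z) = ip \<sigma> up (D_sol z) + z * ip \<sigma> (D_sol z) (D_sol z)"
    unfolding ip_add[OF up_L2 L2_scale[OF sL] sL] ip_scale ..
  moreover have "ip \<sigma> up (D_sol z) = cnj (D_fun z)"
    unfolding ip_cnj[of up] up_coeff_D_sol[OF z, symmetric] by (simp add: ip_def up_coeff_def up_def)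
  moreover have "ip \<sigma> (\<lambda>t. up t + z * D_sol z t) (D_sol z) = cnj (ip \<sigma> (\<lambda>t. up t + z * D_sol z t) (D_sol z))"
    using D_op_symmetric[OF s s] ip_cnj[of "D_sol z" "\<lambda>t. up t + z * D_sol z t"] by simp
  then have "Im (ip \<sigma> (\<lambda>t. up t + z * D_sol z t) (D_sol z)) = 0"
    by (metis Reals_cnj_iff complex_is_Real_iff)
  ultimately have "Im (cnj (D_fun z) + z * ip \<sigma> (D_sol z) (D_sol z)) = 0" by simp
  then show ?thesis by (simp add: ip_def integral_norm_sq)
qed

lemma D_fun_cnj: "D_fun (cnj z) = cnj (D_fun z)"
  by (simp add: D_fun_def psi_cnj)

text \<open>The correction term of D is a multiple of e_(p-1), of degree below p, so it never
  cancels the leading term: each application raises the degree by exactly one. Hence the image can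
  be compared with the monomial in both directions.\<close>

lemma up_in_Domain_D_op_power:
  assumes k: "k \<ge> 1"
  shows "up \<in> Domain (D_op ^^ k) \<longleftrightarrow> pval (monom 1 (p + k)) \<in> L2 \<sigma>"
proof -
  have poly_form: "\<exists>q. degree q = p + i \<and> f \<in> L2 \<sigma> \<and> (AE t in \<sigma>. f t = pval q t) \<and> perp p f"
    if "(up, f) \<in> D_op ^^ i" for i f
    using that
  proof (induction i arbitrary: f)
    case 0
    then have "f = up" by simp
    moreover have "degree (Polynomial.smult (of_real \<beta>) (E p)) = p"
      using \<beta>_pos by (simp add: degree_E)
    moreover have "AE t in \<sigma>. up t = pval (Polynomial.smult (of_real \<beta>) (E p)) t"
      by (simp add: up_def)
    ultimately show ?case using up_L2 perp_up by (metis add_0_right)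
  next
    case (Suc i)
    then obtain g where g: "(up, g) \<in> D_op ^^ i" "(g, f) \<in> D_op" by auto
    from Suc.IH[OF g(1)] obtain q where q: "degree q = p + i" "AE t in \<sigma>. g t = pval q t" by blast
    have f: "f \<in> L2 \<sigma>" "AE t in \<sigma>. f t = of_real t * g t - up_coeff g * pval (E (p - 1)) t"
      using g(2) by (auto simp: D_op_iff)
    define r where "r = pCons 0 q + Polynomial.smult (- up_coeff g) (E (p - 1))"
    have "q \<noteq> 0" using q(1) p_pos by auto
    then have "degree (pCons 0 q) = p + Suc i" using q by simp
    moreover from this have "degree (Polynomial.smult (- up_coeff g) (E (p - 1))) < degree (pCons 0 q)"
      using le_less_trans[OF degree_smult_le[of "- up_coeff g" "E (p - 1)"]] by (simp add: degree_E)
    ultimately have "degree r = p + Suc i"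
      unfolding r_def by (metis degree_add_eq_left)
    moreover have "AE t in \<sigma>. f t = pval r t"
      using f(2) q(2) by eventually_elim (simp add: r_def)
    ultimately show ?case using f(1) D_op_range[OF g(2)] by blast
  qed
  show ?thesis
  proof
    assume "up \<in> Domain (D_op ^^ k)"
    then obtain f where "(up, f) \<in> D_op ^^ k" by blast
    from poly_form[OF this] obtain q where q: "degree q = p + k" "f \<in> L2 \<sigma>" "AE t in \<sigma>. f t = pval q t"
      by blast
    from q(3) have "AE t in \<sigma>. pval q t = f t" by eventually_elim simp
    then have "pval q \<in> L2 \<sigma>" by (rule L2_cong_AE[OF q(2) pval_measurable])
    then show "pval (monom 1 (p + k)) \<in> L2 \<sigma>"
      by (rule L2_pval_degree_mono) (use q(1) p_pos in \<open>auto simp: degree_monom_eq\<close>)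
  next
    have "\<exists>f. (up, f) \<in> D_op ^^ i" if "pval (monom 1 (p + i)) \<in> L2 \<sigma>" for i
      using that
    proof (induction i)
      case (Suc i)
      have mono: "pval r \<in> L2 \<sigma>" if "degree r \<le> p + Suc i" for r
        by (rule L2_pval_degree_mono[OF Suc.prems]) (use that in \<open>simp_all add: degree_monom_eq monom_eq_0_iff\<close>)
      from Suc.IH[OF mono] obtain f where f: "(up, f) \<in> D_op ^^ i" by (auto simp: degree_monom_eq)
      from poly_form[OF f] obtain q where q: "degree q = p + i" "f \<in> L2 \<sigma>" "AE t in \<sigma>. f t = pval q t"
        "perp p f" by blast
      have [measurable]: "f \<in> borel_measurable borel" using q(2) by (rule L2_measurable)
      have shift: "pval (pCons 0 q) \<in> L2 \<sigma>"
        by (rule mono) (use q(1) in \<open>auto intro: order.trans[OF degree_pCons_le]\<close>)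
      have ae: "AE t in \<sigma>. of_real t * f t = pval (pCons 0 q) t"
        using q(3) by eventually_elim simp
      have "(\<lambda>t. of_real t * f t) \<in> L2 \<sigma>" by (rule L2_cong_AE[OF shift _ ae]) measurable
      from D_op_I[OF q(4) this] f show ?case by auto
    qed auto
    then show "pval (monom 1 (p + k)) \<in> L2 \<sigma> \<Longrightarrow> up \<in> Domain (D_op ^^ k)" by blast
  qed
qed

end

section \<open>The fractional linear relation\<close>

lemma expandable_mult_tendsto_0:
  assumes "expandable b M f" "(g \<longlongrightarrow> 0) at_infinity"
  shows "((\<lambda>y. f y * g y) \<longlongrightarrow> 0) at_infinity"
proof -
  have "g \<in> o[at_infinity](\<lambda>_. 1)"
    using assms(2) by (intro smalloI_tendsto) auto
  then have "(\<lambda>y. f y * g y) \<in> o[at_infinity](\<lambda>_. 1)"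
    using landau_o.small_1_mult[OF _ expandable_bounded[OF assms(1)], of g] by (simp add: mult.commute)
  from smalloD_tendsto[OF this] show ?thesis by simp
qed

text \<open>Since f is bounded and w tends to 0, the denominator tends to 1 and can be inverted
  without loss of order. The inverse transformation has the same form with - f.\<close>

lemma expandable_moebius:
  assumes f: "expandable b M f" and M: "M \<ge> 1" and w: "(w \<longlongrightarrow> 0) at_infinity"
  shows "expandable b M w \<Longrightarrow> expandable b M (\<lambda>y. w y / (1 + f y * w y))"
    and "((\<lambda>y. w y / (1 + f y * w y)) \<longlongrightarrow> 0) at_infinity"
proof -
  have lim: "((\<lambda>y. 1 + f y * w y) \<longlongrightarrow> 1 + 0) at_infinity"
    by (intro tendsto_add tendsto_const expandable_mult_tendsto_0[OF f w])
  have one: "expandable b M (\<lambda>y. 1)" using expandable_rpoly[of b M 1] by simp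
  show "expandable b M (\<lambda>y. w y / (1 + f y * w y))" if we: "expandable b M w"
    using expandable_mult[OF we expandable_inverse[OF expandable_add[OF one expandable_mult[OF f we]] lim _ M]]
    by simp
  show "((\<lambda>y. w y / (1 + f y * w y)) \<longlongrightarrow> 0) at_infinity"
    using tendsto_divide[OF w lim] by simp
qed

lemma rpoly_holomorphic: "rpoly q holomorphic_on S"
  unfolding rpoly_altdef[abs_def] by (intro holomorphic_intros)

lemma imaginary_axis_not_real: "\<forall>\<^sub>F y::real in at_infinity. \<i> * of_real y \<notin> \<real>"
  using xi_nonzero by eventually_elim (auto simp: xi_def complex_is_Real_iff)

context orthonormal_polys
begin

section \<open>The Stieltjes transform and polynomials of the second kind\<close>

definition stieltjes :: "complex \<Rightarrow> complex" where
  "stieltjes z = (\<integral>t. kern z t \<partial>\<sigma>)"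

lemma kern_L2: "z \<notin> \<real> \<Longrightarrow> kern z \<in> L2 \<sigma>"
  using L2_kern[of z "\<lambda>t. 1"] by (simp add: L2_def)

text \<open>Integrate (t^i - z^i) / (t - z), the sum of z^(i - 1 - l) t^l over l < i, term by term.
  The coefficients are real combinations of moments, so that \<open>rpoly\<close> applies. For
  constant q the sum is empty and the truncated bound \<open>degree q - 1\<close> is still
  correct.\<close>

lemma second_kind_poly:
  assumes q: "degree q \<le> p"
  shows "\<exists>r. degree r \<le> degree q - 1 \<and>
    (\<forall>z. z \<notin> \<real> \<longrightarrow> (\<integral>t. (of_real (poly q t) - rpoly q z) * kern z t \<partial>\<sigma>) = rpoly r z)"
proof -
  define \<mu> where "\<mu> = (\<lambda>l. \<integral>t. t ^ l \<partial>\<sigma>)"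
  define r where "r = (\<Sum>i\<le>degree q. \<Sum>l<i. monom (coeff q i * \<mu> l) (i - Suc l))"
  have "degree r \<le> degree q - 1"
    unfolding r_def by (intro degree_sum_le) (auto intro!: order.trans[OF degree_monom_le])
  moreover have "(\<integral>t. (of_real (poly q t) - rpoly q z) * kern z t \<partial>\<sigma>) = rpoly r z" if z: "z \<notin> \<real>" for z
  proof -
    have int: "complex_integrable \<sigma> (\<lambda>t. of_real t ^ l)" if "l < degree q" for l
    proof -
      have "pval (monom 1 l) \<in> L2 \<sigma>"
        using that q by (intro pval_L2 order.trans[OF degree_monom_le]) simp
      from L2_integrable[OF this pval_L2[of 1]] show ?thesis by simp
    qed
    have mom: "(\<integral>t. complex_of_real t ^ l \<partial>\<sigma>) = of_real (\<mu> l)" for l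
      using integral_complex_of_real[of \<sigma> "\<lambda>t. t ^ l"] by (simp add: \<mu>_def)
    have "(of_real (poly q t) - rpoly q z) * kern z t
        = (\<Sum>i\<le>degree q. \<Sum>l<i. of_real (coeff q i) * z ^ (i - Suc l) * of_real t ^ l)" for t
    proof -
      have "(of_real (poly q t) - rpoly q z) * kern z t
          = (\<Sum>i\<le>degree q. of_real (coeff q i) * (of_real t ^ i - z ^ i)) * kern z t"
        unfolding rpoly_of_real[symmetric] rpoly_altdef
        by (simp add: sum_subtractf right_diff_distrib)
      also have "\<dots> = (\<Sum>i\<le>degree q. of_real (coeff q i) * (\<Sum>l<i. z ^ (i - Suc l) * of_real t ^ l)
          * ((of_real t - z) * kern z t))"
        unfolding power_diff_sumr2 sum_distrib_right by (simp add: mult_ac)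
      also have "\<dots> = (\<Sum>i\<le>degree q. \<Sum>l<i. of_real (coeff q i) * z ^ (i - Suc l) * of_real t ^ l)"
        unfolding kern_mult[OF z] by (simp add: sum_distrib_left mult.assoc)
      finally show ?thesis .
    qed
    then have "(\<integral>t. (of_real (poly q t) - rpoly q z) * kern z t \<partial>\<sigma>)
        = (\<integral>t. (\<Sum>i\<le>degree q. \<Sum>l<i. of_real (coeff q i) * z ^ (i - Suc l) * of_real t ^ l) \<partial>\<sigma>)"
      by simp
    also have "\<dots> = (\<Sum>i\<le>degree q. \<integral>t. (\<Sum>l<i. of_real (coeff q i) * z ^ (i - Suc l) * of_real t ^ l) \<partial>\<sigma>)"
      by (intro Bochner_Integration.integral_sum Bochner_Integration.integrable_sum
          integrable_mult_right int) auto
    also have "\<dots> = (\<Sum>i\<le>degree q. \<Sum>l<i. \<integral>t. of_real (coeff q i) * z ^ (i - Suc l) * of_real t ^ l \<partial>\<sigma>)"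
      by (intro sum.cong refl Bochner_Integration.integral_sum integrable_mult_right int) auto
    also have "\<dots> = (\<Sum>i\<le>degree q. \<Sum>l<i. of_real (coeff q i) * z ^ (i - Suc l) * of_real (\<mu> l))"
      by (simp add: mom)
    also have "\<dots> = rpoly r z" by (simp add: r_def mult_ac)
    finally show ?thesis .
  qed
  ultimately show ?thesis by blast
qed

text \<open>Serves two purposes: for k = p it shows that a00 = - r / e_p is a rational function, and
  it reduces holomorphy of \<open>psi\<close> to that of n.\<close>

lemma psi_eq_stieltjes:
  assumes k: "k \<le> p"
  shows "\<exists>r. degree r \<le> k - 1 \<and>
    (\<forall>z. z \<notin> \<real> \<longrightarrow> psi k z = rpoly (e k) z * stieltjes z + rpoly r z)"
proof -
  obtain r where r: "degree r \<le> k - 1"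
    "\<And>z. z \<notin> \<real> \<Longrightarrow> (\<integral>t. (of_real (poly (e k) t) - rpoly (e k) z) * kern z t \<partial>\<sigma>) = rpoly r z"
    using second_kind_poly[of "e k"] k by (auto simp: degree_e)
  have "psi k z = rpoly (e k) z * stieltjes z + rpoly r z" if z: "z \<notin> \<real>" for z
  proof -
    have "integrable \<sigma> (\<lambda>t. 1 * kern z t)" "integrable \<sigma> (\<lambda>t. pval (E k) t * kern z t)"
      using L2_integrable[OF pval_L2[of 1] kern_L2[OF z]] L2_integrable[OF E_L2[OF k] kern_L2[OF z]]
      by simp_all
    then have "(\<integral>t. (pval (E k) t - rpoly (e k) z) * kern z t \<partial>\<sigma>) = psi k z - rpoly (e k) z * stieltjes z"
      by (simp add: left_diff_distrib psi_def stieltjes_def)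
    then show ?thesis using r(2)[OF z] by (simp add: E_def pval_of_real_poly)
  qed
  with r(1) show ?thesis by blast
qed

section \<open>Closed forms of the coefficients and the formula for \<open>n\<close>\<close>

lemma a00_eq:
  assumes z: "z \<notin> \<real>"
  shows "ip \<sigma> (app (resolvent (compression \<sigma> (mult_op \<sigma>) (poly_span \<sigma> p)) z) (\<lambda>t. 1)) (\<lambda>t. 1)
    = stieltjes z - psi p z / poly (E p) z"
proof -
  have "pval 1 = (\<lambda>t. 1)" by auto
  with ip_app_resolvent_span[OF z, of 1 1] p_pos show ?thesis by (simp add: stieltjes_def)
qed

text \<open>The Wronskian identity eliminates both transforms, leaving a rational function; likewise
  in \<open>a11_eq\<close>.\<close>

lemma a_eq:
  assumes z: "z \<notin> \<real>"
  shows "ip \<sigma> (app (resolvent (compression \<sigma> (mult_op \<sigma>) (poly_span \<sigma> p)) z) (\<lambda>t. 1)) (pval (E (p - 1)))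
    = - 1 / (of_real \<beta> * poly (E p) z)"
proof -
  have "pval 1 = (\<lambda>t. 1)" by auto
  with ip_app_resolvent_span[OF z, of 1 "E (p - 1)"] p_pos
  have "ip \<sigma> (app (resolvent (compression \<sigma> (mult_op \<sigma>) (poly_span \<sigma> p)) z) (\<lambda>t. 1)) (pval (E (p - 1)))
    = psi (p - 1) z - poly (E (p - 1)) z * psi p z / poly (E p) z"
    by (simp add: degree_E psi_def)
  also have "\<dots> = - 1 / (of_real \<beta> * poly (E p) z)"
    unfolding psi_wronskian[OF z] using E_psi_nonzero(1)[of p z] z \<beta>_pos by (simp add: field_simps)
  finally show ?thesis .
qed

lemma a11_eq:
  assumes z: "z \<notin> \<real>"
  shows "ip \<sigma> (app (resolvent (compression \<sigma> (mult_op \<sigma>) (poly_span \<sigma> p)) z) (pval (E (p - 1)))) (pval (E (p - 1)))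
    = - poly (E (p - 1)) z / (of_real \<beta> * poly (E p) z)"
proof -
  have "ip \<sigma> (app (resolvent (compression \<sigma> (mult_op \<sigma>) (poly_span \<sigma> p)) z) (pval (E (p - 1)))) (pval (E (p - 1)))
    = poly (E (p - 1)) z * psi (p - 1) z
      - poly (E (p - 1)) z * (poly (E (p - 1)) z * psi p z) / poly (E p) z"
    using ip_app_resolvent_span[OF z, of "E (p - 1)" "E (p - 1)"] p_pos
      integral_E_pval_kern'[of "p - 1" "E (p - 1)" z] z
    by (simp add: degree_E mult_ac)
  also have "\<dots> = - poly (E (p - 1)) z / (of_real \<beta> * poly (E p) z)"
    unfolding psi_wronskian[OF z] using E_psi_nonzero(1)[of p z] z \<beta>_pos by (simp add: field_simps)
  finally show ?thesis .
qed

text \<open>The Wronskian identity collapses a11 n_p - 1 to 1 / (\<beta> e_p psi_(p-1)), which is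
  never 0. The numerator is a00 (a11 n_p - 1) - a^2 n_p, and the quotient of its last term by the
  denominator restores psi_p / e_p.\<close>

lemma stieltjes_moebius:
  assumes z: "z \<notin> \<real>"
    and a00: "a00 = stieltjes z - psi p z / poly (E p) z"
    and a: "a = - 1 / (of_real \<beta> * poly (E p) z)"
    and a11: "a11 = - poly (E (p - 1)) z / (of_real \<beta> * poly (E p) z)"
  shows "a11 * D_fun z - 1 \<noteq> 0"
    and "stieltjes z = ((a00 * a11 - a\<^sup>2) * D_fun z - a00) / (a11 * D_fun z - 1)"
proof -
  define x where "x = poly (E p) z"
  define y where "y = poly (E (p - 1)) z"
  define P where "P = psi p z"
  define Q where "Q = psi (p - 1) z"
  have nz: "x \<noteq> 0" "Q \<noteq> 0" "of_real \<beta> \<noteq> (0::complex)"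
    using E_psi_nonzero z \<beta>_pos by (auto simp: x_def Q_def)
  have W: "y * P = x * Q + 1 / of_real \<beta>"
    unfolding x_def y_def P_def Q_def by (rule psi_wronskian[OF z])
  have mz: "D_fun z = - of_real \<beta> * P / Q" by (simp add: D_fun_def P_def Q_def)
  have "a11 = - y / (of_real \<beta> * x)" by (simp add: a11 x_def y_def)
  then have "a11 * D_fun z = y * P / (x * Q)"
    using nz by (simp add: mz)
  also have "\<dots> = 1 + 1 / (of_real \<beta> * x * Q)"
    unfolding W using nz by (simp add: field_simps)
  finally have d: "a11 * D_fun z - 1 = 1 / (of_real \<beta> * x * Q)" by simp
  then show nz': "a11 * D_fun z - 1 \<noteq> 0" using nz by simp
  have "(a00 * a11 - a\<^sup>2) * D_fun z - a00 = a00 * (a11 * D_fun z - 1) - a\<^sup>2 * D_fun z"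
    by (simp add: algebra_simps)
  also have "a\<^sup>2 * D_fun z = - (P / x) * (1 / (of_real \<beta> * x * Q))"
    using nz by (simp add: a mz x_def[symmetric] power2_eq_square field_simps)
  also have "a00 * (a11 * D_fun z - 1) - - (P / x) * (1 / (of_real \<beta> * x * Q))
      = stieltjes z * (a11 * D_fun z - 1)"
    unfolding d by (simp add: a00 P_def x_def algebra_simps)
  finally show "stieltjes z = ((a00 * a11 - a\<^sup>2) * D_fun z - a00) / (a11 * D_fun z - 1)"
    using nz' by simp
qed

text \<open>The counterpart of \<open>n\<^sub>p\<close> for \<open>A\<close> itself, \<open>((A - z)\<^sup>-\<^sup>1 u\<^sub>p, u\<^sub>p)\<close>. Since \<open>n = a\<^sub>0\<^sub>0 + a\<^sup>2 A_fun\<close> and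
  \<open>1 / n\<^sub>p = 1 / A_fun + a\<^sub>1\<^sub>1\<close>, it transfers asymptotic expansions between \<open>n\<close> and \<open>n\<^sub>p\<close>.\<close>
definition A_fun :: "complex \<Rightarrow> complex" where
  "A_fun z = (of_real \<beta>)\<^sup>2 * (\<integral>t. pval (E p) t * pval (E p) t * kern z t \<partial>\<sigma>)"

section \<open>Transfer of expansions between \<open>n\<close> and \<open>n\<^sub>p\<close>\<close>

lemma A_fun_eq: "z \<notin> \<real> \<Longrightarrow> A_fun z = (of_real \<beta>)\<^sup>2 * (rpoly (e p) z * psi p z)"
  unfolding A_fun_def rpoly_e by (subst integral_E_pval_kern') (simp_all add: degree_E)

lemma A_fun_tendsto: "((\<lambda>y. A_fun (\<i> * of_real y)) \<longlongrightarrow> 0) at_infinity"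
proof -
  have "integrable \<sigma> (\<lambda>t. pval (E p) t * pval (E p) t)"
    by (rule L2_integrable[OF E_p_L2 E_p_L2])
  from tendsto_mult[OF tendsto_const integral_kern_tendsto[OF this], of "(of_real \<beta>)\<^sup>2"]
  show ?thesis by (simp add: A_fun_def)
qed

lemma stieltjes_tendsto: "((\<lambda>y. stieltjes (\<i> * of_real y)) \<longlongrightarrow> 0) at_infinity"
  using integral_kern_tendsto[of "\<lambda>t. 1"] by (simp add: stieltjes_def)

text \<open>Here \<open>f\<close> is a11. Both directions are stated in the shape required by
  \<open>expandable_moebius\<close>.\<close>

lemma D_fun_A_fun:
  assumes z: "z \<notin> \<real>"
  defines "f \<equiv> - rpoly (e (p - 1)) z / (of_real \<beta> * rpoly (e p) z)"
  shows "D_fun z = A_fun z / (1 + f * A_fun z)" "A_fun z = D_fun z / (1 + - f * D_fun z)"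
proof -
  define x where "x = rpoly (e p) z"
  define y where "y = rpoly (e (p - 1)) z"
  define P where "P = psi p z"
  define Q where "Q = psi (p - 1) z"
  have nz: "x \<noteq> 0" "Q \<noteq> 0" "of_real \<beta> \<noteq> (0::complex)"
    using E_psi_nonzero z \<beta>_pos by (auto simp: x_def Q_def rpoly_e)
  have W: "y * P = x * Q + 1 / of_real \<beta>"
    unfolding x_def y_def P_def Q_def rpoly_e by (rule psi_wronskian[OF z])
  have wz: "A_fun z = (of_real \<beta>)\<^sup>2 * (x * P)" by (simp add: A_fun_eq[OF z] x_def P_def)
  have mz: "D_fun z = - of_real \<beta> * P / Q" by (simp add: D_fun_def P_def Q_def)
  have f: "f = - y / (of_real \<beta> * x)" by (simp add: f_def x_def y_def)
  have "f * A_fun z = - of_real \<beta> * (y * P)"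
    using nz by (simp add: f wz power2_eq_square)
  also have "\<dots> = - of_real \<beta> * x * Q - 1"
    unfolding W using nz by (simp add: algebra_simps)
  finally have "1 + f * A_fun z = - of_real \<beta> * x * Q" by simp
  then show "D_fun z = A_fun z / (1 + f * A_fun z)"
    using nz by (simp add: mz wz power2_eq_square)
  have "- f * D_fun z = - (y * P) / (x * Q)"
    using nz by (simp add: f mz)
  also have "\<dots> = - 1 - 1 / (of_real \<beta> * x * Q)"
    unfolding W using nz by (simp add: field_simps)
  finally have "1 + - f * D_fun z = - 1 / (of_real \<beta> * x * Q)" by simp
  then show "A_fun z = D_fun z / (1 + - f * D_fun z)"
    using nz by (simp add: mz wz power2_eq_square)
qed

text \<open>The coefficient a11 is rational with degrees p - 1 over p, hence expandable to every
  order, and the two Moebius transformations are inverse to each other.\<close>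

lemma D_fun_tendsto: "((\<lambda>y. D_fun (\<i> * of_real y)) \<longlongrightarrow> 0) at_infinity"
  and expandable_D_fun_iff: "M \<ge> 1 \<Longrightarrow>
    expandable b M (\<lambda>y. D_fun (\<i> * of_real y)) \<longleftrightarrow> expandable b M (\<lambda>y. A_fun (\<i> * of_real y))"
proof -
  define f where "f = (\<lambda>y::real. - rpoly (e (p - 1)) (\<i> * of_real y) / (of_real \<beta> * rpoly (e p) (\<i> * of_real y)))"
  have f: "expandable b M f" if "M \<ge> 1" for b M
  proof -
    have "expandable b M (\<lambda>y. rpoly (- e (p - 1)) (\<i> * of_real y) / rpoly (Polynomial.smult \<beta> (e p)) (\<i> * of_real y))"
      using \<beta>_pos E_neq_0[of p] that
      by (intro expandable_rational) (auto simp: degree_e E_def)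
    then show ?thesis by (simp add: f_def)
  qed
  have 1: "\<forall>\<^sub>F y in at_infinity. D_fun (\<i> * of_real y) = A_fun (\<i> * of_real y) / (1 + f y * A_fun (\<i> * of_real y))"
    using imaginary_axis_not_real unfolding f_def by eventually_elim (rule D_fun_A_fun(1))
  have 2: "\<forall>\<^sub>F y in at_infinity. A_fun (\<i> * of_real y) = D_fun (\<i> * of_real y) / (1 + - f y * D_fun (\<i> * of_real y))"
    using imaginary_axis_not_real unfolding f_def by eventually_elim (rule D_fun_A_fun(2))
  \<comment> \<open>The limit comes first: the transformation back to \<open>A_fun\<close> is
    admissible only for a function that tends to 0.\<close>
  show lim: "((\<lambda>y. D_fun (\<i> * of_real y)) \<longlongrightarrow> 0) at_infinity"
    using expandable_moebius(2)[OF f[of 1 True] _ A_fun_tendsto] tendsto_cong[OF 1] by simp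
  show "expandable b M (\<lambda>y. D_fun (\<i> * of_real y)) \<longleftrightarrow> expandable b M (\<lambda>y. A_fun (\<i> * of_real y))" if M: "M \<ge> 1"
    using expandable_moebius(1)[OF f[OF M] M A_fun_tendsto, of b]
      expandable_moebius(1)[OF expandable_uminus[OF f[OF M]] M lim, of b]
    unfolding expandable_cong[OF 1, symmetric] expandable_cong[OF 2, symmetric] by blast
qed

text \<open>This is n - a00 = a^2 A_fun, with \<open>f\<close> = - a00 and a^2 =
  \<open>xi ^ (2 * p) * g\<close>. Since \<open>X\<close> and \<open>Y\<close> have equal degree,
  \<open>g\<close> and its reciprocal \<open>h\<close> are both expandable, so \<open>g\<close>
  costs no order and the power of \<open>xi\<close> accounts for the whole shift.\<close>

lemma expandable_stieltjes_iff:
  assumes M: "M \<ge> 1"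
  shows "expandable b (2 * p + M) (\<lambda>y. stieltjes (\<i> * of_real y)) \<longleftrightarrow> expandable b M (\<lambda>y. A_fun (\<i> * of_real y))"
proof -
  obtain r where deg: "degree r \<le> p - 1"
    and r: "\<And>z. z \<notin> \<real> \<Longrightarrow> psi p z = rpoly (e p) z * stieltjes z + rpoly r z"
    using psi_eq_stieltjes[of p] by blast
  define X where "X = monom (1::real) (2 * p)"
  define Y where "Y = Polynomial.smult (\<beta>\<^sup>2) (e p ^ 2)"
  have ep: "e p \<noteq> 0" using lc_pos[of p] by (auto simp: lc_def)
  have degs: "degree X = 2 * p" "degree Y = 2 * p" "X \<noteq> 0" "Y \<noteq> 0"
    using ep \<beta>_pos by (auto simp: X_def Y_def degree_monom_eq degree_power_eq degree_e monom_eq_0_iff)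
  define f where "f = (\<lambda>y::real. rpoly r (\<i> * of_real y) / rpoly (e p) (\<i> * of_real y))"
  define g where "g = (\<lambda>y::real. rpoly X (\<i> * of_real y) / rpoly Y (\<i> * of_real y))"
  define h where "h = (\<lambda>y::real. rpoly Y (\<i> * of_real y) / rpoly X (\<i> * of_real y))"
  have f: "expandable b N f" if "N \<ge> 1" for N
    unfolding f_def by (rule expandable_rational[OF _ ep that]) (use deg in \<open>simp add: degree_e\<close>)
  have g: "expandable b M g" and h: "expandable b M h"
    unfolding g_def h_def by (rule expandable_rational; use degs M in simp)+
  have bdd: "(\<lambda>y. g y * A_fun (\<i> * of_real y)) \<in> O[at_infinity](\<lambda>_. 1)"
    by (rule tendsto_bounded[OF expandable_mult_tendsto_0[OF g A_fun_tendsto]])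
  have 1: "\<forall>\<^sub>F y in at_infinity. stieltjes (\<i> * of_real y) + f y = xi y ^ (2 * p) * (g y * A_fun (\<i> * of_real y))"
    using imaginary_axis_not_real
  proof eventually_elim
    case (elim y)
    define z where "z = \<i> * complex_of_real y"
    have z: "z \<notin> \<real>" using elim by (simp add: z_def)
    then have nz: "z \<noteq> 0" "rpoly (e p) z \<noteq> 0" "of_real \<beta> \<noteq> (0::complex)"
      using E_psi_nonzero(1)[of p z] \<beta>_pos by (auto simp: rpoly_e)
    have "stieltjes z + rpoly r z / rpoly (e p) z = psi p z / rpoly (e p) z"
      unfolding r[OF z] using nz by (simp add: field_simps)
    also have "\<dots> = (1 / z) ^ (2 * p) * (rpoly X z / rpoly Y z * A_fun z)"
      using nz by (simp add: A_fun_eq[OF z] X_def Y_def power_divide power2_eq_square)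
    finally show ?case by (simp add: f_def g_def z_def xi_def)
  qed
  have 2: "\<forall>\<^sub>F y in at_infinity. h y * (g y * A_fun (\<i> * of_real y)) = A_fun (\<i> * of_real y)"
    using imaginary_axis_not_real
  proof eventually_elim
    case (elim y)
    then have "\<i> * complex_of_real y \<noteq> 0" "rpoly (e p) (\<i> * of_real y) \<noteq> 0"
      using E_psi_nonzero(1)[of p "\<i> * of_real y"] by (auto simp: rpoly_e)
    then have "h y * g y = 1" using \<beta>_pos by (simp add: g_def h_def X_def Y_def)
    then show ?case by (simp flip: mult.assoc)
  qed
  have N: "2 * p + M \<ge> 1" using M by simp
  have "expandable b (2 * p + M) (\<lambda>y. stieltjes (\<i> * of_real y))
      \<longleftrightarrow> expandable b (2 * p + M) (\<lambda>y. stieltjes (\<i> * of_real y) + f y)"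
  proof
    show "expandable b (2 * p + M) (\<lambda>y. stieltjes (\<i> * of_real y) + f y)"
      if "expandable b (2 * p + M) (\<lambda>y. stieltjes (\<i> * of_real y))"
      by (rule expandable_add[OF that f[OF N]])
    show "expandable b (2 * p + M) (\<lambda>y. stieltjes (\<i> * of_real y))"
      if "expandable b (2 * p + M) (\<lambda>y. stieltjes (\<i> * of_real y) + f y)"
      by (rule iffD1[OF expandable_cong expandable_diff[OF that f[OF N]]]) simp
  qed
  also have "\<dots> \<longleftrightarrow> expandable b M (\<lambda>y. g y * A_fun (\<i> * of_real y))"
    by (rule trans[OF expandable_cong[OF 1] expandable_shift[OF bdd]])
  also have "\<dots> \<longleftrightarrow> expandable b M (\<lambda>y. A_fun (\<i> * of_real y))"
  proof
    show "expandable b M (\<lambda>y. g y * A_fun (\<i> * of_real y))" if "expandable b M (\<lambda>y. A_fun (\<i> * of_real y))"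
      by (rule expandable_mult[OF g that])
    show "expandable b M (\<lambda>y. A_fun (\<i> * of_real y))" if "expandable b M (\<lambda>y. g y * A_fun (\<i> * of_real y))"
      by (rule iffD1[OF expandable_cong[OF 2] expandable_mult[OF h that]])
  qed
  finally show ?thesis .
qed

text \<open>Both functions tend to 0 along the axis, so both properties are statements on
  expandability, and the order indices differ by 2 p. The case k = 0 is included.\<close>

lemma has_property_iff:
  assumes j: "j \<in> {1, 2, 3}"
    and n: "\<And>z. z \<notin> \<real> \<Longrightarrow> n z = stieltjes z" and n': "\<And>z. z \<notin> \<real> \<Longrightarrow> n' z = D_fun z"
  shows "has_property j (p + k) n \<longleftrightarrow> has_property j k n'"
proof -
  have 1: "\<forall>\<^sub>F y in at_infinity. n (\<i> * of_real y) = stieltjes (\<i> * of_real y)"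
    using imaginary_axis_not_real by eventually_elim (rule n)
  have 2: "\<forall>\<^sub>F y in at_infinity. n' (\<i> * of_real y) = D_fun (\<i> * of_real y)"
    using imaginary_axis_not_real by eventually_elim (rule n')
  have idx: "order_index j (p + k) = 2 * p + order_index j k" "order_index j k \<ge> 1"
    by (simp_all add: order_index_def)
  have "has_property j (p + k) n \<longleftrightarrow> expandable (j \<noteq> 2) (2 * p + order_index j k) (\<lambda>y. stieltjes (\<i> * of_real y))"
    using has_property_iff_expandable[OF j, of n] stieltjes_tendsto
    unfolding tendsto_cong[OF 1] expandable_cong[OF 1] idx(1)[symmetric] by blast
  also have "\<dots> \<longleftrightarrow> expandable (j \<noteq> 2) (order_index j k) (\<lambda>y. D_fun (\<i> * of_real y))"
    unfolding expandable_D_fun_iff[OF idx(2)] by (rule expandable_stieltjes_iff[OF idx(2)])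
  also have "\<dots> \<longleftrightarrow> has_property j k n'"
    using has_property_iff_expandable[OF j, of n'] D_fun_tendsto
    unfolding tendsto_cong[OF 2] expandable_cong[OF 2] by blast
  finally show ?thesis .
qed

text \<open>Holomorphy is read off from a quotient of expressions linear in n with polynomial
  coefficients, whose denominator is psi_(p-1) and has no zeros there; the sign comes from
  \<open>Im_D_fun\<close>.\<close>

lemma nevanlinna_D_fun:
  assumes n: "nevanlinna n" and nz: "\<And>z. z \<notin> \<real> \<Longrightarrow> n z = stieltjes z"
    and n': "\<And>z. z \<notin> \<real> \<Longrightarrow> n' z = D_fun z"
  shows "nevanlinna n'"
proof -
  have open_half: "open {z. Im z > 0}" by (rule open_halfspace_Im_gt)
  have nonreal: "z \<notin> \<real>" if "Im z \<noteq> 0" for z using that by (auto simp: complex_is_Real_iff)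
  obtain r r' where r: "\<And>z. z \<notin> \<real> \<Longrightarrow> psi p z = rpoly (e p) z * stieltjes z + rpoly r z"
    and r': "\<And>z. z \<notin> \<real> \<Longrightarrow> psi (p - 1) z = rpoly (e (p - 1)) z * stieltjes z + rpoly r' z"
    using psi_eq_stieltjes[of p] psi_eq_stieltjes[of "p - 1"] by auto
  have nhol: "n holomorphic_on {z. Im z > 0}"
    using n open_half by (simp add: nevanlinna_def analytic_on_open)
  have "(\<lambda>z. - of_real \<beta> * (rpoly (e p) z * n z + rpoly r z)
      / (rpoly (e (p - 1)) z * n z + rpoly r' z)) holomorphic_on {z. Im z > 0}"
  proof (intro holomorphic_intros rpoly_holomorphic nhol)
    fix z assume "z \<in> {z. Im z > 0}"
    then have z: "z \<notin> \<real>" by (intro nonreal) simp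
    then show "rpoly (e (p - 1)) z * n z + rpoly r' z \<noteq> 0"
      using E_psi_nonzero(2)[of "p - 1" z] by (simp add: nz r' del: One_nat_def)
  qed
  then have "n' holomorphic_on {z. Im z > 0}"
    by (rule holomorphic_transform) (auto simp: n' nonreal nz D_fun_def r r' simp del: One_nat_def)
  moreover have "Im (n' z) \<ge> 0" if "Im z > 0" for z
    using that Im_D_fun[OF nonreal] by (simp add: n' nonreal)
  moreover have "n' z = cnj (n' (cnj z))" if "Im z < 0" for z
    using that by (simp add: n' nonreal D_fun_cnj)
  ultimately show ?thesis using open_half by (simp add: nevanlinna_def analytic_on_open)
qed

end

theorem theorem5p1:
  fixes n n\<^sub>p a00 a11 a r :: "complex \<Rightarrow> complex"
    and p j :: nat
    and s :: "nat \<Rightarrow> real"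
    and \<sigma> :: "real measure"
    and e :: "nat \<Rightarrow> real poly"
    and u u\<^sub>p :: "real \<Rightarrow> complex"
    and H\<^sub>p H\<^sub>p' :: "(real \<Rightarrow> complex) set"
    and A A\<^sub>0 D :: "(real \<Rightarrow> complex) rel"
    and b :: complex
  assumes "p \<ge> 1" and "j \<in> {1, 2, 3}"
    and "nevanlinna n"
    and "has_expansion j p n s"
    and "Determinant.det (Matrix.mat (p + 1) (p + 1) (\<lambda>(i, l). s (i + l))) \<noteq> 0"
    and "finite_measure \<sigma>" and "sets \<sigma> = sets borel"
    and "\<And>z. z \<notin> \<real> \<Longrightarrow> n z = (\<integral>t. 1 / (of_real t - z) \<partial>\<sigma>)"
    and "A = mult_op \<sigma>" and "u = (\<lambda>t. 1)"
    and "H\<^sub>p = poly_span \<sigma> p" and "H\<^sub>p' = ortho \<sigma> H\<^sub>p"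
    and "A\<^sub>0 = compression \<sigma> A H\<^sub>p" and "D = compression \<sigma> A H\<^sub>p'"
    and "first_kind_polys \<sigma> p e"
    and "b = ip \<sigma> (app A (poly_fun (e (p - 1)))) (poly_fun (e p))"
    and "u\<^sub>p = (\<lambda>t. b * poly_fun (e p) t)"
    and "a00 = (\<lambda>z. ip \<sigma> (app (resolvent A\<^sub>0 z) u) u)"
    and "a11 = (\<lambda>z. ip \<sigma> (app (resolvent A\<^sub>0 z) (poly_fun (e (p - 1)))) (poly_fun (e (p - 1))))"
    and "a = (\<lambda>z. ip \<sigma> (app (resolvent A\<^sub>0 z) u) (poly_fun (e (p - 1))))"
    and "r = (\<lambda>z. a00 z * a11 z - (a z)\<^sup>2)"
    and "n\<^sub>p = (\<lambda>z. ip \<sigma> (app (resolvent D z) u\<^sub>p) u\<^sub>p)"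
  shows "(\<forall>z. z \<notin> \<real> \<longrightarrow> n z = ip \<sigma> (app (resolvent A z) u) u)
    \<and> self_adjoint_in \<sigma> H\<^sub>p' D
    \<and> b \<in> \<real> \<and> 0 < Re b \<and> u\<^sub>p \<in> H\<^sub>p'
    \<and> (\<forall>z. z \<notin> \<real> \<longrightarrow>
          a11 z * n\<^sub>p z - 1 \<noteq> 0 \<and> n z = (r z * n\<^sub>p z - a00 z) / (a11 z * n\<^sub>p z - 1))
    \<and> nevanlinna n\<^sub>p
    \<and> has_property j 0 n\<^sub>p
    \<and> (\<forall>k\<ge>1. (u \<in> Domain (A ^^ (p + k)) \<longleftrightarrow> u\<^sub>p \<in> Domain (D ^^ k))
          \<and> (has_property j (p + k) n \<longleftrightarrow> has_property j k n\<^sub>p))"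
proof -
  interpret finite_measure \<sigma> by fact
  interpret orthonormal_polys \<sigma> e p
    by unfold_locales fact+
  note [simp] = \<open>A = mult_op \<sigma>\<close> \<open>u = (\<lambda>t. 1)\<close> \<open>H\<^sub>p = poly_span \<sigma> p\<close> \<open>H\<^sub>p' = ortho \<sigma> H\<^sub>p\<close>
    \<open>A\<^sub>0 = compression \<sigma> A H\<^sub>p\<close> \<open>D = compression \<sigma> A H\<^sub>p'\<close>
  have n: "n z = stieltjes z" if "z \<notin> \<real>" for z
    using assms(8)[OF that] by (simp add: stieltjes_def kern_def)
  have b: "b = of_real \<beta>"
    using ip_app_mult_op_E by (simp add: \<open>b = _\<close>)
  have up: "u\<^sub>p = up"
    by (simp add: \<open>u\<^sub>p = _\<close> b poly_fun_e up_def fun_eq_iff)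
  have np: "n\<^sub>p z = D_fun z" if "z \<notin> \<real>" for z
    using ip_app_resolvent_D_op[OF that] by (simp add: \<open>n\<^sub>p = _\<close> up)
  have resolvent_A: "n z = ip \<sigma> (app (resolvent A z) u) u" if z: "z \<notin> \<real>" for z
    using ip_app_resolvent_mult_op[OF z, of "\<lambda>t. 1" "\<lambda>t. 1"] n[OF z]
    by (simp add: stieltjes_def L2_def)
  have fraction: "a11 z * n\<^sub>p z - 1 \<noteq> 0 \<and> n z = (r z * n\<^sub>p z - a00 z) / (a11 z * n\<^sub>p z - 1)"
    if z: "z \<notin> \<real>" for z
  proof -
    have "a00 z = stieltjes z - psi p z / poly (E p) z"
      "a z = - 1 / (of_real \<beta> * poly (E p) z)"
      "a11 z = - poly (E (p - 1)) z / (of_real \<beta> * poly (E p) z)"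
      using a00_eq[OF z] a_eq[OF z] a11_eq[OF z]
      by (simp_all add: \<open>a00 = _\<close> \<open>a = _\<close> \<open>a11 = _\<close> poly_fun_e)
    from stieltjes_moebius[OF z this] show ?thesis
      by (simp add: n[OF z] np[OF z] \<open>r = _\<close>)
  qed
  have "has_property j p n" using \<open>has_expansion j p n s\<close> by (auto simp: has_property_def)
  \<comment> \<open>The transfer with k = 0 turns the given property of index p into one of index
    0.\<close>
  then have "has_property j 0 n\<^sub>p"
    using has_property_iff[OF \<open>j \<in> {1, 2, 3}\<close> n np, of 0] by simp
  moreover have "u \<in> Domain (A ^^ (p + k)) \<longleftrightarrow> u\<^sub>p \<in> Domain (D ^^ k)" if "k \<ge> 1" for k
    using one_in_Domain_mult_op_power up_in_Domain_D_op_power[OF that] by (simp add: up)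
  moreover have "u\<^sub>p \<in> H\<^sub>p'" using perp_up by (simp add: up ortho_span_iff)
  ultimately show ?thesis
    using resolvent_A D_op_self_adjoint \<beta>_pos fraction nevanlinna_D_fun[OF \<open>nevanlinna n\<close> n np]
      has_property_iff[OF \<open>j \<in> {1, 2, 3}\<close> n np]
    by (auto simp: b)
qed

end
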